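(* Let $n\ge 1$ and $m$ be integers with $n-1\le m\le \binom{n}{2}$ and let $B(n,m)=\max\{\delta(G): G\in\mathcal{G}(n,m)\}$. Then: (1) if $n\ge 1$ and $m=n-1$, then $B(n,m)=0$; (2) if $n\ge 3$ and $n\le m\le n+3$, then $B(n,m)=n/4$; (3) if $n_0$ is an integer with $5\le n_0\le n$ and $$n+\binom{n_0-2}{2}<m\le n+\binom{n_0-1}{2},$$ then $B(n,m)\ge \dfrac{n-n_0+3}{4}$.
   Context: $\mathcal{G}(n,m)$ is the set of simple connected graphs with $n$ vertices and $m$ edges, in which every edge has length $1$. A graph $G$ is regarded as a metric space whose points are the vertices together with all interior points of edges: each edge is identified isometrically with $[0,1]$ and $d(x,y)$ is the length of a shortest path in $G$ joining $x$ and $y$; this makes $G$ a geodesic metric space. A geodesic triangle $T$ with vertices $x_1,x_2,x_3\in G$ (arbitrary points, not necessarily graph vertices, possibly repeated) is a union of three geodesics $[x_1x_2],[x_2x_3],[x_3x_1]$. It is $\delta$-thin if every point of each side is at distance at most $\delta$ from the union of the two other sides; $\delta(T)$ is the infimum of the $\delta\ge 0$ for which $T$ is $\delta$-thin, and the hyperbolicity constant is $\delta(G)=\sup\{\delta(T): T \text{ a geodesic triangle in } G\}$. *)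

theory Defs
  imports Complex_Main "Graph_Theory.Graph_Theory"
begin

section \<open>Hyperbolicity constant of a metric space\<close>

text \<open>A metric space is given by a carrier \<open>M\<close> and a distance \<open>d\<close>. A geodesic is the image of an
  isometric embedding of a compact interval; it may be degenerate (\<open>L = 0\<close>).\<close>

definition is_geodesic :: "'p set \<Rightarrow> ('p \<Rightarrow> 'p \<Rightarrow> real) \<Rightarrow> 'p \<Rightarrow> 'p \<Rightarrow> 'p set \<Rightarrow> bool" where
  "is_geodesic M d x y S \<longleftrightarrow>
     (\<exists>L \<gamma>. 0 \<le> L \<and> \<gamma> \<in> {0..L} \<rightarrow> M \<and> \<gamma> 0 = x \<and> \<gamma> L = y \<and>
        (\<forall>s\<in>{0..L}. \<forall>t\<in>{0..L}. d (\<gamma> s) (\<gamma> t) = \<bar>s - t\<bar>) \<and> S = \<gamma> ` {0..L})"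

definition is_geodesic_triangle ::
    "'p set \<Rightarrow> ('p \<Rightarrow> 'p \<Rightarrow> real) \<Rightarrow> 'p set \<times> 'p set \<times> 'p set \<Rightarrow> bool" where
  "is_geodesic_triangle M d T \<longleftrightarrow>
     (case T of (A, B, C) \<Rightarrow> \<exists>x1\<in>M. \<exists>x2\<in>M. \<exists>x3\<in>M.
        is_geodesic M d x1 x2 A \<and> is_geodesic M d x2 x3 B \<and> is_geodesic M d x3 x1 C)"

definition dist_to_set :: "('p \<Rightarrow> 'p \<Rightarrow> real) \<Rightarrow> 'p \<Rightarrow> 'p set \<Rightarrow> real" where
  "dist_to_set d p S = (INF q\<in>S. d p q)"

definition thin_triangle ::
    "('p \<Rightarrow> 'p \<Rightarrow> real) \<Rightarrow> real \<Rightarrow> 'p set \<times> 'p set \<times> 'p set \<Rightarrow> bool" where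
  "thin_triangle d \<delta> T \<longleftrightarrow>
     (case T of (A, B, C) \<Rightarrow>
        (\<forall>p\<in>A. dist_to_set d p (B \<union> C) \<le> \<delta>) \<and>
        (\<forall>p\<in>B. dist_to_set d p (C \<union> A) \<le> \<delta>) \<and>
        (\<forall>p\<in>C. dist_to_set d p (A \<union> B) \<le> \<delta>))"

definition triangle_thinness ::
    "('p \<Rightarrow> 'p \<Rightarrow> real) \<Rightarrow> 'p set \<times> 'p set \<times> 'p set \<Rightarrow> real" where
  "triangle_thinness d T = Inf {\<delta>. 0 \<le> \<delta> \<and> thin_triangle d \<delta> T}"

text \<open>The supremum is taken in the reals, so this is meaningful only for spaces in which the
  thinness of triangles is bounded. That covers all bounded spaces, in particular the metric
  graphs of finite connected graphs.\<close>

definition hyperbolicity :: "'p set \<Rightarrow> ('p \<Rightarrow> 'p \<Rightarrow> real) \<Rightarrow> real" where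
  "hyperbolicity M d = (SUP T\<in>{T. is_geodesic_triangle M d T}. triangle_thinness d T)"


section \<open>The metric graph of a simple graph\<close>

text \<open>A point is represented by its barycentric coordinates, a function on the vertices:
  \<open>edge_point u v t\<close> is the point of the edge \<open>uv\<close> at distance \<open>t\<close> from \<open>u\<close>. Thus
  \<open>edge_point u v t = edge_point v u (1 - t)\<close>, and the endpoints \<open>t = 0\<close> and \<open>t = 1\<close> are the
  vertices \<open>u\<close> and \<open>v\<close>, whichever incident edge is used to describe them.\<close>

definition vertex_point :: "'a \<Rightarrow> 'a \<Rightarrow> real" where
  "vertex_point v = (\<lambda>w. if w = v then 1 else 0)"

definition edge_point :: "'a \<Rightarrow> 'a \<Rightarrow> real \<Rightarrow> 'a \<Rightarrow> real" where
  "edge_point u v t = (\<lambda>w. (1 - t) * vertex_point u w + t * vertex_point v w)"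

definition graph_points :: "'a pair_pre_digraph \<Rightarrow> ('a \<Rightarrow> real) set" where
  "graph_points G =
     vertex_point ` pverts G \<union> {edge_point u v t |u v t. (u, v) \<in> parcs G \<and> 0 < t \<and> t < 1}"

text \<open>\<open>graph_path G x y l\<close>: some path from \<open>x\<close> to \<open>y\<close>, made of finitely many segments each lying
  in one closed edge, has length \<open>l\<close>.\<close>

inductive graph_path :: "'a pair_pre_digraph \<Rightarrow> ('a \<Rightarrow> real) \<Rightarrow> ('a \<Rightarrow> real) \<Rightarrow> real \<Rightarrow> bool"
  for G where
  refl: "x \<in> graph_points G \<Longrightarrow> graph_path G x x 0"
| step: "\<lbrakk>graph_path G x (edge_point u v s) l; (u, v) \<in> parcs G; s \<in> {0..1}; t \<in> {0..1}\<rbrakk>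
    \<Longrightarrow> graph_path G x (edge_point u v t) (l + \<bar>s - t\<bar>)"

definition graph_dist :: "'a pair_pre_digraph \<Rightarrow> ('a \<Rightarrow> real) \<Rightarrow> ('a \<Rightarrow> real) \<Rightarrow> real" where
  "graph_dist G x y = Inf {l. graph_path G x y l}"

definition graph_hyperbolicity :: "'a pair_pre_digraph \<Rightarrow> real" where
  "graph_hyperbolicity G = hyperbolicity (graph_points G) (graph_dist G)"


section \<open>Graphs of given order and size\<close>

text \<open>The locale \<open>pair_graph\<close> describes finite simple undirected graphs by symmetric irreflexive
  arc relations, each edge giving two arcs. As the hyperbolicity constant is invariant under
  isomorphism, the vertex set is fixed to be \<open>{..<n}\<close>, so that \<open>graphs_of n m\<close> is a finite set and
  the maximum below is one over finitely many values.\<close>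

definition graphs_of :: "nat \<Rightarrow> nat \<Rightarrow> nat pair_pre_digraph set" where
  "graphs_of n m =
     {G. pair_graph G \<and> connected (with_proj G) \<and> pverts G = {..<n} \<and>
         card {{u, v} |u v. (u, v) \<in> parcs G} = m}"

definition max_hyperbolicity :: "nat \<Rightarrow> nat \<Rightarrow> real" where
  "max_hyperbolicity n m = Max (graph_hyperbolicity ` graphs_of n m)"

end

theory Submission
  imports Defs
begin

text \<open>
  Upper bound: let \<open>p\<close> lie on one side of a geodesic triangle at distance \<open>D\<close> from the union of the
  other two. The part of the side inside the ball of radius \<open>D\<close> around \<open>p\<close> is a geodesic of length
  \<open>2 * D\<close>, and its ends are joined outside the ball by the rest of the triangle. The geodesic passes
  through about \<open>2 * D\<close> vertices inside the ball; a walk joining its ends through vertices outside the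
  ball needs about \<open>2 * D\<close> further vertices, as the ends are at distance \<open>2 * D\<close>. The fractional parts
  at the two ends cancel, so \<open>4 * D \<le> n\<close>. In a tree every edge is a bridge, so the rest of the triangle
  has to pass through every inner point of the side.

  Lower bound: a cycle of length \<open>L\<close> is split into two geodesics by a vertex and its opposite point, and
  the midpoint of one is at distance \<open>L / 4\<close> from the other. This persists after adding further
  edges as long as two functions on the vertices remain 1-Lipschitz. Among such edges are all edges of
  the clique on a vertex of the cycle, its two neighbours on the cycle and all vertices outside the cycle.
\<close>

section \<open>Points and distances of a metric graph\<close>

text \<open>The distance is an infimum over paths and a geodesic is just an isometric map, so
  neither hands over a sequence of vertices. Two devices replace it. Bounds from below on distances
  come from functions that are 1-Lipschitz on every closed edge. Connections outside a ball come
  from labels: a truth value attached to the set of vertices with nonzero coordinate is constant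
  along a curve as soon as it does not change where the curve leaves a vertex. Membership in a
  component of the graph outside the ball, taken as a label, then yields a walk in that component.

  The limits on \<open>m\<close> are edge counts. In the third claim the cycle has length
  \<open>L = n - n\<^sub>0 + 3\<close>, so the clique has \<open>n\<^sub>0\<close> vertices; for
  \<open>L > 3\<close> it contains two edges of the cycle, and the binomial coefficient
  \<open>n\<^sub>0 choose 2\<close> plus the other \<open>L - 2\<close> edges is
  \<open>n + ((n\<^sub>0 - 1) choose 2)\<close>. In the second claim, \<open>n + 3\<close> counts a
  cycle through all vertices and three chords.\<close>

lemma edge_point_0 [simp]: "edge_point u v 0 = vertex_point u"
  and edge_point_1 [simp]: "edge_point u v 1 = vertex_point v"
  by (simp_all add: edge_point_def)

lemma edge_point_swap: "edge_point v u t = edge_point u v (1 - t)"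
  by (auto simp: edge_point_def fun_eq_iff)

lemma edge_point_left: "u \<noteq> v \<Longrightarrow> edge_point u v t u = 1 - t"
  and edge_point_right: "u \<noteq> v \<Longrightarrow> edge_point u v t v = t"
  by (auto simp: edge_point_def vertex_point_def)

lemma vertex_point_inject [simp]: "vertex_point u = vertex_point v \<longleftrightarrow> u = v"
  by (auto simp: vertex_point_def fun_eq_iff split: if_splits)

text \<open>The cell of the point: \<open>{v}\<close> for a vertex, the two ends for an inner point
  of an edge. Labels of curves depend on a point through this set only.\<close>

definition point_supp :: "('a \<Rightarrow> real) \<Rightarrow> 'a set" where
  "point_supp P = {w. P w \<noteq> 0}"

lemma point_supp_vertex [simp]: "point_supp (vertex_point v) = {v}"
  by (auto simp: point_supp_def vertex_point_def)

lemma point_supp_edge: "u \<noteq> v \<Longrightarrow> 0 < t \<Longrightarrow> t < 1 \<Longrightarrow> point_supp (edge_point u v t) = {u, v}"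
  by (auto simp: point_supp_def edge_point_def vertex_point_def)

locale connected_pair_graph = pair_graph G for G :: "'a pair_pre_digraph" (structure) +
  assumes connected_graph: "connected (with_proj G)"
begin

abbreviation "V \<equiv> pverts G"
abbreviation "E \<equiv> parcs G"
abbreviation "X \<equiv> graph_points G"
abbreviation "d \<equiv> graph_dist G"

lemma E_sym: "(u, v) \<in> E \<Longrightarrow> (v, u) \<in> E"
  using symD[of E u v] pair_sym_arcs by (simp add: symmetric_def)

lemma E_neq: "(u, v) \<in> E \<Longrightarrow> u \<noteq> v"
  using pair_no_loops by fastforce

lemma E_V: "(u, v) \<in> E \<Longrightarrow> u \<in> V" "(u, v) \<in> E \<Longrightarrow> v \<in> V"
  using in_arcsD1 in_arcsD2 by auto

lemma V_nonempty: "V \<noteq> {}"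
  using connected_graph by (auto simp: connected_def strongly_connected_def)

lemma E_rtrancl:
  assumes "u \<in> V" "v \<in> V"
  shows "(u, v) \<in> E\<^sup>*"
proof -
  have "parcs (mk_symmetric (with_proj G)) = E"
    using adj_mk_symmetric_eq pair_sym_arcs by simp
  then have "(u, v) \<in> rtrancl_on V E"
    using connected_graph assms
    by (auto simp: connected_def strongly_connected_def reachable_def)
  then show ?thesis by (rule rtrancl_on_rtranclI)
qed

lemma vertex_point_in_X: "v \<in> V \<Longrightarrow> vertex_point v \<in> X"
  by (simp add: graph_points_def)

lemma edge_point_in_X:
  assumes "(u, v) \<in> E" "0 \<le> t" "t \<le> 1"
  shows "edge_point u v t \<in> X"
proof -
  consider "t = 0" | "t = 1" | "0 < t" "t < 1" using assms by linarith
  then show ?thesis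
    by cases (use assms E_V in \<open>auto simp: graph_points_def\<close>)
qed

lemma X_cases [consumes 1, case_names vertex edge]:
  assumes "P \<in> X"
  obtains v where "v \<in> V" "P = vertex_point v"
  | u v t where "(u, v) \<in> E" "0 < t" "t < 1" "P = edge_point u v t"
  using assms by (auto simp: graph_points_def)

lemma path_nonneg: "graph_path G x y l \<Longrightarrow> 0 \<le> l"
  by (induction rule: graph_path.induct) auto

lemma path_trans:
  assumes "graph_path G y z l2" "graph_path G x y l1"
  shows "graph_path G x z (l1 + l2)"
  using assms
proof (induction rule: graph_path.induct)
  case (step x' u v s l t)
  then show ?case
    using graph_path.step[of G x u v s "l1 + l" t] by (simp add: add.assoc)
qed simp

lemma path_segment:
  assumes "(u, v) \<in> E" "s \<in> {0..1}" "t \<in> {0..1}"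
  shows "graph_path G (edge_point u v s) (edge_point u v t) \<bar>s - t\<bar>"
  using graph_path.step[OF graph_path.refl assms] edge_point_in_X assms by auto

lemma path_sym: "graph_path G x y l \<Longrightarrow> graph_path G y x l"
proof (induction rule: graph_path.induct)
  case (step x u v s l t)
  show ?case
    using path_trans[OF step.IH path_segment[OF step.hyps(2,4,3)]]
    by (simp add: add.commute abs_minus_commute)
qed (rule graph_path.refl)

lemma path_exists_vertices:
  assumes "(u, v) \<in> E\<^sup>*" "u \<in> V"
  shows "\<exists>l. graph_path G (vertex_point u) (vertex_point v) l"
  using assms
proof (induction rule: rtrancl_induct)
  case base
  then show ?case using graph_path.refl vertex_point_in_X by blast
next
  case (step v w)
  then obtain l where "graph_path G (vertex_point u) (vertex_point v) l" by blast
  then show ?case using path_trans[OF path_segment[of v w 0 1]] step.hyps(2) by fastforce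
qed

lemma path_exists_to_vertex:
  assumes "P \<in> X"
  shows "\<exists>v\<in>V. \<exists>l. graph_path G P (vertex_point v) l"
  using assms
proof (cases rule: X_cases)
  case (vertex v)
  then show ?thesis using graph_path.refl[OF assms] by blast
next
  case (edge u v t)
  then show ?thesis using path_segment[of u v t 0] E_V by (intro bexI[of _ u]) auto
qed

lemma path_exists:
  assumes "P \<in> X" "Q \<in> X"
  shows "\<exists>l. graph_path G P Q l"
proof -
  obtain u k where u: "u \<in> V" "graph_path G P (vertex_point u) k"
    using path_exists_to_vertex[OF assms(1)] by blast
  obtain v l where v: "v \<in> V" "graph_path G Q (vertex_point v) l"
    using path_exists_to_vertex[OF assms(2)] by blast
  obtain j where "graph_path G (vertex_point u) (vertex_point v) j"
    using path_exists_vertices[OF E_rtrancl[OF u(1) v(1)] u(1)] by blast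
  then show ?thesis using path_trans[OF path_trans[OF path_sym[OF v(2)]] u(2)] by blast
qed

lemma bdd_below_path_lengths: "bdd_below {l. graph_path G x y l}"
  using path_nonneg by (intro bdd_belowI[of _ 0]) auto

lemma dist_le_path: "graph_path G x y l \<Longrightarrow> d x y \<le> l"
  unfolding graph_dist_def by (intro cInf_lower bdd_below_path_lengths) simp

lemma dist_greatest:
  assumes "x \<in> X" "y \<in> X" "\<And>l. graph_path G x y l \<Longrightarrow> c \<le> l"
  shows "c \<le> d x y"
  unfolding graph_dist_def using assms path_exists[OF assms(1,2)] by (intro cInf_greatest) auto

lemma dist_nonneg: "x \<in> X \<Longrightarrow> y \<in> X \<Longrightarrow> 0 \<le> d x y"
  by (rule dist_greatest) (auto intro: path_nonneg)

lemma dist_self [simp]: "x \<in> X \<Longrightarrow> d x x = 0"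
  using dist_le_path[OF graph_path.refl] dist_nonneg by (simp add: order_antisym)

lemma dist_sym: "d x y = d y x"
proof -
  have "{l. graph_path G x y l} = {l. graph_path G y x l}" using path_sym by blast
  then show ?thesis by (simp add: graph_dist_def)
qed

lemma dist_triangle:
  assumes "x \<in> X" "y \<in> X" "z \<in> X"
  shows "d x z \<le> d x y + d y z"
proof -
  have "d x z - l \<le> d y z" if l: "graph_path G x y l" for l
    using dist_le_path[OF path_trans[OF _ l]] assms
    by (intro dist_greatest) (auto simp: algebra_simps)
  then have "d x z - d y z \<le> d x y" using assms
    by (intro dist_greatest) (auto simp: algebra_simps)
  then show ?thesis by simp
qed

lemma dist_edge_le:
  assumes "(u, v) \<in> E" "s \<in> {0..1}" "t \<in> {0..1}"
  shows "d (edge_point u v s) (edge_point u v t) \<le> \<bar>s - t\<bar>"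
  using path_segment[OF assms] by (rule dist_le_path)

text \<open>A path is a chain of segments in closed edges, so the bound on the increase of
  \<open>F\<close> along a segment adds up along the path. Such functions are the source of bounds
  from below on an infimum over paths.\<close>

lemma lipschitz_le_dist:
  fixes F :: "('a \<Rightarrow> real) \<Rightarrow> real"
  assumes "x \<in> X" "y \<in> X"
    and F: "\<And>u v s t. (u, v) \<in> E \<Longrightarrow> s \<in> {0..1} \<Longrightarrow> t \<in> {0..1} \<Longrightarrow>
        F (edge_point u v t) - F (edge_point u v s) \<le> \<bar>s - t\<bar>"
  shows "F y - F x \<le> d x y"
proof (rule dist_greatest[OF assms(1,2)])
  fix l assume "graph_path G x y l"
  then show "F y - F x \<le> l"
  proof (induction rule: graph_path.induct)
    case (step x u v s l t)
    then show ?case using F[of u v s t] by linarith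
  qed simp
qed

text \<open>Along an edge each coordinate is affine with slope -1, 0 or 1. Hence coordinates are
  continuous along isometric curves, and distances within an edge are differences of
  parameters.\<close>

lemma coordinate_le_dist:
  assumes "x \<in> X" "y \<in> X"
  shows "\<bar>x w - y w\<bar> \<le> d x y"
proof -
  have "edge_point u v t w - edge_point u v s w \<le> \<bar>s - t\<bar>" if "(u, v) \<in> E" for u v s t
    using E_neq[OF that] by (auto simp: edge_point_def vertex_point_def algebra_simps)
  then have "y w - x w \<le> d x y" "x w - y w \<le> d y x"
    using lipschitz_le_dist[of x y "\<lambda>P. P w"] lipschitz_le_dist[of y x "\<lambda>P. P w"] assms by auto
  then show ?thesis using dist_sym[of x y] by linarith
qed

lemma dist_edge:
  assumes "(u, v) \<in> E" "s \<in> {0..1}" "t \<in> {0..1}"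
  shows "d (edge_point u v s) (edge_point u v t) = \<bar>s - t\<bar>"
  using dist_edge_le[OF assms] coordinate_le_dist[of "edge_point u v s" "edge_point u v t" v]
    edge_point_in_X assms E_neq by (fastforce simp: edge_point_right)

lemma X_nonneg: "P \<in> X \<Longrightarrow> 0 \<le> P w"
  by (cases rule: X_cases) (auto simp: vertex_point_def edge_point_def)

lemma point_supp_two:
  assumes "P \<in> X" "u \<in> point_supp P" "v \<in> point_supp P" "u \<noteq> v"
  shows "(u, v) \<in> E \<and> point_supp P = {u, v} \<and> 0 < P v \<and> P v < 1 \<and> P = edge_point u v (P v)"
  using assms(1)
proof (cases rule: X_cases)
  case (vertex w)
  then show ?thesis using assms by auto
next
  case (edge a b t)
  then have ab: "a \<noteq> b" using E_neq by blast
  then have s: "point_supp P = {a, b}" using point_supp_edge[OF ab edge(2,3)] edge(4) by simp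
  then have "u = a \<and> v = b \<or> u = b \<and> v = a" using assms by auto
  then show ?thesis using edge ab s E_sym edge_point_swap[of a b t]
    by (auto simp: edge_point_left edge_point_right)
qed

end

text \<open>Arbitrary intervals, in place of the \<open>{0..L}\<close> of
  \<open>is_geodesic\<close>, make the restriction to a subinterval an isometric curve without
  reparametrisation.\<close>

definition isometric_curve :: "'p set \<Rightarrow> ('p \<Rightarrow> 'p \<Rightarrow> real) \<Rightarrow> (real \<Rightarrow> 'p) \<Rightarrow> real \<Rightarrow> real \<Rightarrow> bool" where
  "isometric_curve M d \<gamma> a b \<longleftrightarrow> \<gamma> \<in> {a..b} \<rightarrow> M \<and> (\<forall>s\<in>{a..b}. \<forall>t\<in>{a..b}. d (\<gamma> s) (\<gamma> t) = \<bar>s - t\<bar>)"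

lemma isometric_curve_sub:
  "isometric_curve M d \<gamma> a b \<Longrightarrow> a \<le> a' \<Longrightarrow> b' \<le> b \<Longrightarrow> isometric_curve M d \<gamma> a' b'"
  by (auto simp: isometric_curve_def)

lemma isometric_curve_in: "isometric_curve M d \<gamma> a b \<Longrightarrow> a \<le> t \<Longrightarrow> t \<le> b \<Longrightarrow> \<gamma> t \<in> M"
  by (auto simp: isometric_curve_def)

lemma isometric_curve_dist:
  "isometric_curve M d \<gamma> a b \<Longrightarrow> a \<le> s \<Longrightarrow> s \<le> b \<Longrightarrow> a \<le> t \<Longrightarrow> t \<le> b \<Longrightarrow> d (\<gamma> s) (\<gamma> t) = \<bar>s - t\<bar>"
  by (auto simp: isometric_curve_def)

text \<open>The distances of \<open>g t\<close> to \<open>g a\<close> and \<open>g b\<close> add up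
  to the distance between these two, so \<open>g t\<close> lies between them and its position is
  forced; the sign is settled by \<open>g b\<close>.\<close>

lemma real_isometry:
  fixes g :: "real \<Rightarrow> real"
  assumes "a \<le> b" "\<And>s t. s \<in> {a..b} \<Longrightarrow> t \<in> {a..b} \<Longrightarrow> \<bar>g s - g t\<bar> = \<bar>s - t\<bar>"
  shows "(\<forall>t\<in>{a..b}. g t = g a + (t - a)) \<or> (\<forall>t\<in>{a..b}. g t = g a - (t - a))"
proof -
  have *: "\<bar>g a - g b\<bar> = b - a" "\<And>t. t \<in> {a..b} \<Longrightarrow> \<bar>g a - g t\<bar> = t - a"
      "\<And>t. t \<in> {a..b} \<Longrightarrow> \<bar>g t - g b\<bar> = b - t"
    using assms(1) assms(2)[of a b] assms(2)[of a] assms(2)[of _ b] by auto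
  have "g b = g a + (b - a) \<or> g b = g a - (b - a)" using *(1) by linarith
  then show ?thesis
  proof
    assume "g b = g a + (b - a)"
    then have "\<forall>t\<in>{a..b}. g t = g a + (t - a)" using *(2,3) by (smt (verit))
    then show ?thesis by blast
  next
    assume "g b = g a - (b - a)"
    then have "\<forall>t\<in>{a..b}. g t = g a - (t - a)" using *(2,3) by (smt (verit))
    then show ?thesis by blast
  qed
qed

context connected_pair_graph
begin

lemma isometric_curve_coordinate_continuous:
  assumes "isometric_curve X d \<gamma> a b"
  shows "continuous_on {a..b} (\<lambda>t. \<gamma> t w)"
  unfolding continuous_on_def
proof (intro ballI tendstoI)
  fix t e assume t: "t \<in> {a..b}" and e: "(0::real) < e"
  have "dist (\<gamma> t' w) (\<gamma> t w) < e" if "t' \<in> {a..b}" "dist t' t < e" for t'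
    using coordinate_le_dist[of "\<gamma> t'" "\<gamma> t" w] that t isometric_curve_dist[OF assms, of t' t]
      isometric_curve_in[OF assms] by (auto simp: dist_real_def)
  then show "\<forall>\<^sub>F t' in at t within {a..b}. dist (\<gamma> t' w) (\<gamma> t w) < e"
    using e by (auto simp: eventually_at)
qed

text \<open>A positive coordinate stays positive for a while, so near \<open>t\<close> the support
  can only grow. It is unchanged near an inner point of an edge, whose support is as large as
  possible, and may jump at a vertex.\<close>

lemma eventually_in_point_supp:
  assumes "isometric_curve X d \<gamma> a b" "t \<in> {a..b}" "w \<in> point_supp (\<gamma> t)"
  shows "\<forall>\<^sub>F s in at t within {a..b}. w \<in> point_supp (\<gamma> s)"
proof -
  have "0 < \<gamma> t w"
    using X_nonneg[of "\<gamma> t" w] assms by (auto simp: point_supp_def isometric_curve_def Pi_def order_less_le)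
  moreover have "((\<lambda>t. \<gamma> t w) \<longlongrightarrow> \<gamma> t w) (at t within {a..b})"
    using isometric_curve_coordinate_continuous[OF assms(1)] assms(2) by (simp add: continuous_on_def)
  ultimately have "\<forall>\<^sub>F s in at t within {a..b}. 0 < \<gamma> s w" by (rule order_tendstoD(1)[rotated])
  then show ?thesis by eventually_elim (simp add: point_supp_def)
qed

text \<open>Away from vertices the support has two elements and cannot grow, so it is locally
  constant and the curve stays in one open edge. The coordinate at \<open>v\<close> is then an
  isometry into the reals; if it decreases, the edge is read in the other direction.\<close>

lemma isometric_curve_on_edge:
  assumes \<gamma>: "isometric_curve X d \<gamma> a b" and ab: "a < b"
    and nv: "\<And>t. a < t \<Longrightarrow> t < b \<Longrightarrow> \<gamma> t \<notin> vertex_point ` V"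
  obtains u v \<tau> where "(u, v) \<in> E" "0 \<le> \<tau>" "\<tau> + (b - a) \<le> 1"
    "\<And>t. a \<le> t \<Longrightarrow> t \<le> b \<Longrightarrow> \<gamma> t = edge_point u v (\<tau> + (t - a))"
proof -
  have two: "\<exists>u v. u \<noteq> v \<and> point_supp (\<gamma> t) = {u, v}" if "a < t" "t < b" for t
  proof -
    have "\<gamma> t \<in> X" using isometric_curve_in[OF \<gamma>] that by simp
    then show ?thesis
    proof (cases rule: X_cases)
      case (edge u v s)
      then show ?thesis using point_supp_edge[OF E_neq] E_neq by metis
    qed (use nv[OF that] in blast)
  qed
  define c where "c = (a + b) / 2"
  have c: "a < c" "c < b" using ab by (auto simp: c_def)
  obtain u v where uv: "u \<noteq> v" "point_supp (\<gamma> c) = {u, v}" using two c by blast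
  have const: "point_supp (\<gamma> s) = point_supp (\<gamma> t)" if "s \<in> {a<..<b}" "t \<in> {a<..<b}" for s t
  proof (rule connected_local_const[of "{a<..<b}"])
    show "\<forall>t\<in>{a<..<b}. \<forall>\<^sub>F s in at t within {a<..<b}. point_supp (\<gamma> t) = point_supp (\<gamma> s)"
    proof
      fix t assume t: "t \<in> {a<..<b}"
      then obtain u v where uv: "u \<noteq> v" "point_supp (\<gamma> t) = {u, v}" using two[of t] by auto
      have "\<forall>\<^sub>F s in at t within {a<..<b}. w \<in> point_supp (\<gamma> s)" if "w \<in> {u, v}" for w
        using eventually_in_point_supp[OF \<gamma>, of t w] that t uv
        by (intro filter_leD[OF at_le[of "{a<..<b}" "{a..b}"]]) auto
      then have "\<forall>\<^sub>F s in at t within {a<..<b}. u \<in> point_supp (\<gamma> s)"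
        and "\<forall>\<^sub>F s in at t within {a<..<b}. v \<in> point_supp (\<gamma> s)" by auto
      moreover have "\<forall>\<^sub>F s in at t within {a<..<b}. s \<in> {a<..<b}"
        by (simp add: eventually_at_filter)
      ultimately show "\<forall>\<^sub>F s in at t within {a<..<b}. point_supp (\<gamma> t) = point_supp (\<gamma> s)"
      proof eventually_elim
        case (elim s)
        then show ?case using point_supp_two[of "\<gamma> s" u v] uv isometric_curve_in[OF \<gamma>] by auto
      qed
    qed
  qed (use that in auto)
  have edge_open: "(u, v) \<in> E \<and> 0 < \<gamma> t v \<and> \<gamma> t v < 1 \<and> \<gamma> t = edge_point u v (\<gamma> t v)"
    if "a < t" "t < b" for t
    using point_supp_two[of "\<gamma> t" u v] const[of t c] that c uv isometric_curve_in[OF \<gamma>] by auto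
  have uvE: "(u, v) \<in> E" using edge_open c by blast
  have close: "\<exists>s. a < s \<and> s < b \<and> \<bar>s - t\<bar> < e" if "t \<in> {a..b}" "0 < e" for t e
  proof (cases "t \<le> c")
    case True
    then show ?thesis using that c ab
      by (intro exI[of _ "t + min (e/2) ((b - c)/2)"]) (auto simp: min_def field_simps)
  next
    case False
    then show ?thesis using that c ab
      by (intro exI[of _ "t - min (e/2) ((c - a)/2)"]) (auto simp: min_def field_simps)
  qed
  \<comment> \<open>The ends of the interval may be vertices. The relations are carried over to them
    from inner times, as every coordinate changes by at most the elapsed time.\<close>
  have edge: "0 \<le> \<gamma> t v \<and> \<gamma> t v \<le> 1 \<and> \<gamma> t = edge_point u v (\<gamma> t v)" if t: "t \<in> {a..b}" for t
  proof -
    have near: "\<exists>s. a < s \<and> s < b \<and> (\<forall>w. \<bar>\<gamma> s w - \<gamma> t w\<bar> < e)" if e: "0 < e" for e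
    proof -
      obtain s where s: "a < s" "s < b" "\<bar>s - t\<bar> < e" using close[OF t e] by blast
      then have "\<bar>\<gamma> s w - \<gamma> t w\<bar> < e" for w
        using coordinate_le_dist[of "\<gamma> s" "\<gamma> t" w] isometric_curve_dist[OF \<gamma>, of s t]
          isometric_curve_in[OF \<gamma>] t by fastforce
      then show ?thesis using s by blast
    qed
    have "\<gamma> t v \<le> 1"
    proof (rule field_le_epsilon)
      fix e :: real assume "0 < e"
      then show "\<gamma> t v \<le> 1 + e" using near[of e] edge_open by (smt (verit))
    qed
    moreover have "\<bar>\<gamma> t w - edge_point u v (\<gamma> t v) w\<bar> \<le> 0" for w
    proof (rule field_le_epsilon)
      fix e :: real assume "0 < e"
      then obtain s where s: "a < s" "s < b" "\<And>w. \<bar>\<gamma> s w - \<gamma> t w\<bar> < e / 2"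
        using near[of "e/2"] by auto
      have "\<gamma> s w = edge_point u v (\<gamma> s v) w" using edge_open[OF s(1,2)] by metis
      moreover have "\<bar>edge_point u v (\<gamma> s v) w - edge_point u v (\<gamma> t v) w\<bar> \<le> \<bar>\<gamma> s v - \<gamma> t v\<bar>"
        using uv by (auto simp: edge_point_def vertex_point_def algebra_simps)
      ultimately show "\<bar>\<gamma> t w - edge_point u v (\<gamma> t v) w\<bar> \<le> 0 + e"
        using s(3)[of w] s(3)[of v] by linarith
    qed
    then have "\<gamma> t w = edge_point u v (\<gamma> t v) w" for w
      by (meson abs_le_zero_iff eq_iff_diff_eq_0)
    then have "\<gamma> t = edge_point u v (\<gamma> t v)" by (rule ext)
    moreover have "0 \<le> \<gamma> t v" using X_nonneg isometric_curve_in[OF \<gamma>] t by simp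
    ultimately show ?thesis by blast
  qed
  then have range: "0 \<le> \<gamma> t v" "\<gamma> t v \<le> 1"
    and on_edge: "\<gamma> t = edge_point u v (\<gamma> t v)" if "t \<in> {a..b}" for t
    using that by blast+
  have iso: "\<bar>\<gamma> s v - \<gamma> t v\<bar> = \<bar>s - t\<bar>" if "s \<in> {a..b}" "t \<in> {a..b}" for s t
  proof -
    have "d (edge_point u v (\<gamma> s v)) (edge_point u v (\<gamma> t v)) = \<bar>\<gamma> s v - \<gamma> t v\<bar>"
      by (rule dist_edge[OF uvE]) (use range that in simp_all)
    then have "d (\<gamma> s) (\<gamma> t) = \<bar>\<gamma> s v - \<gamma> t v\<bar>"
      by (simp only: on_edge[OF that(1), symmetric] on_edge[OF that(2), symmetric])
    then show ?thesis using isometric_curve_dist[OF \<gamma>, of s t] that by simp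
  qed
  have "(\<forall>t\<in>{a..b}. \<gamma> t v = \<gamma> a v + (t - a)) \<or> (\<forall>t\<in>{a..b}. \<gamma> t v = \<gamma> a v - (t - a))"
    by (rule real_isometry[OF less_imp_le[OF ab] iso])
  then show ?thesis
  proof
    assume *: "\<forall>t\<in>{a..b}. \<gamma> t v = \<gamma> a v + (t - a)"
    have curve: "\<gamma> t = edge_point u v (\<gamma> a v + (t - a))" if "a \<le> t" "t \<le> b" for t
    proof -
      have "\<gamma> t v = \<gamma> a v + (t - a)" using that by (intro *[rule_format]) simp
      then have e: "edge_point u v (\<gamma> t v) = edge_point u v (\<gamma> a v + (t - a))" by (rule arg_cong)
      show ?thesis by (rule trans[OF on_edge[of t] e]) (use that in simp)
    qed
    have "\<gamma> b v = \<gamma> a v + (b - a)" using ab by (intro *[rule_format]) simp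
    then have "\<gamma> a v + (b - a) \<le> 1" using range(2)[of b] ab by simp
    then show ?thesis using range(1)[of a] ab by (intro that[OF uvE _ _ curve]) simp_all
  next
    assume *: "\<forall>t\<in>{a..b}. \<gamma> t v = \<gamma> a v - (t - a)"
    have curve: "\<gamma> t = edge_point v u (1 - \<gamma> a v + (t - a))" if "a \<le> t" "t \<le> b" for t
    proof -
      have "\<gamma> t v = \<gamma> a v - (t - a)" using that by (intro *[rule_format]) simp
      then have "1 - \<gamma> t v = 1 - \<gamma> a v + (t - a)" by simp
      then have e: "edge_point u v (\<gamma> t v) = edge_point v u (1 - \<gamma> a v + (t - a))"
        by (simp only: edge_point_swap[of u v])
      show ?thesis by (rule trans[OF on_edge[of t] e]) (use that in simp)
    qed
    have "\<gamma> b v = \<gamma> a v - (b - a)" using ab by (intro *[rule_format]) simp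
    then have "1 - \<gamma> a v + (b - a) \<le> 1" using range(1)[of b] ab by simp
    then show ?thesis using range(2)[of a] ab by (intro that[OF E_sym[OF uvE] _ _ curve]) simp_all
  qed
qed

end

section \<open>Geodesics outside a ball\<close>

text \<open>There are \<open>card S - 1\<close> gaps between neighbours, each at most 1. Removing
  the minimum preserves the hypothesis, because the larger element that it provides is never the
  minimum. Meant for the times at which a geodesic meets vertices.\<close>

lemma Max_minus_Min_le_card:
  fixes S :: "real set"
  assumes "finite S" "S \<noteq> {}"
    and "\<And>t. t \<in> S \<Longrightarrow> t \<noteq> Max S \<Longrightarrow> \<exists>t'\<in>S. t < t' \<and> t' \<le> t + 1"
  shows "Max S - Min S \<le> real (card S) - 1"
  using assms
proof (induction S rule: finite_linorder_min_induct)
  case (insert b A)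
  show ?case
  proof (cases "A = {}")
    case False
    have bA: "b < a" if "a \<in> A" for a using insert.hyps that by blast
    have "Max A \<in> A" using False insert.hyps by simp
    then have max: "Max (insert b A) = Max A" using False insert.hyps bA by (simp add: max_def less_imp_le)
    have "b \<le> Min A" using False insert.hyps(1) bA by (simp add: less_imp_le)
    then have min: "Min (insert b A) = b" using False insert.hyps(1) by simp
    have "\<exists>t'\<in>A. t < t' \<and> t' \<le> t + 1" if "t \<in> A" "t \<noteq> Max A" for t
    proof -
      have "\<exists>t'\<in>insert b A. t < t' \<and> t' \<le> t + 1"
        using insert.prems(2)[of t] that max by simp
      then show ?thesis using bA[OF that(1)] by auto
    qed
    then have IH: "Max A - Min A \<le> real (card A) - 1" using insert.IH False by blast
    have "b \<noteq> Max A" using bA \<open>Max A \<in> A\<close> by blast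
    then obtain t' where t': "t' \<in> A" "t' \<le> b + 1" using insert.prems(2)[of b] max by auto
    then have "Min A \<le> b + 1" using Min_le[OF insert.hyps(1) t'(1)] by linarith
    moreover have "b \<notin> A" using bA by blast
    ultimately show ?thesis using IH max min insert.hyps(1) by simp
  qed simp
qed simp

context connected_pair_graph
begin

text \<open>Inside an edge the support is locally constant; near a vertex it is \<open>{w}\<close>
  or \<open>{w, w'}\<close>, and the hypothesis identifies their labels. A locally constant label is
  constant on an interval. Only vertices visited by the curve are concerned, so a curve outside a
  ball is controlled by the vertices outside it.\<close>

lemma curve_label_const:
  assumes \<eta>: "isometric_curve X d \<eta> a b" and "a \<le> b"
    and f: "\<And>t w w'. a \<le> t \<Longrightarrow> t \<le> b \<Longrightarrow> \<eta> t = vertex_point w \<Longrightarrow> (w, w') \<in> E \<Longrightarrow> f {w} = f {w, w'}"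
  shows "f (point_supp (\<eta> a)) = f (point_supp (\<eta> b))"
proof (rule connected_local_const[of "{a..b}"])
  show "\<forall>t\<in>{a..b}. \<forall>\<^sub>F s in at t within {a..b}. f (point_supp (\<eta> t)) = f (point_supp (\<eta> s))"
  proof
    fix t assume t: "t \<in> {a..b}"
    have tX: "\<eta> t \<in> X" using isometric_curve_in[OF \<eta>] t by simp
    have in_ab: "\<forall>\<^sub>F s in at t within {a..b}. s \<in> {a..b}" by (simp add: eventually_at_filter)
    show "\<forall>\<^sub>F s in at t within {a..b}. f (point_supp (\<eta> t)) = f (point_supp (\<eta> s))"
      using tX
    proof (cases rule: X_cases)
      case (vertex v)
      have "\<forall>\<^sub>F s in at t within {a..b}. v \<in> point_supp (\<eta> s)"
        using eventually_in_point_supp[OF \<eta> t] vertex by simp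
      with in_ab show ?thesis
      proof eventually_elim
        case (elim s)
        then have sX: "\<eta> s \<in> X" using isometric_curve_in[OF \<eta>] by simp
        show ?case
        proof (cases "point_supp (\<eta> s) = {v}")
          case False
          then obtain v' where "v' \<in> point_supp (\<eta> s)" "v \<noteq> v'" using elim by blast
          then have "(v, v') \<in> E" "point_supp (\<eta> s) = {v, v'}"
            using point_supp_two[OF sX elim(2)] by blast+
          then show ?thesis using f[of t v v'] t vertex by simp
        qed (use vertex in simp)
      qed
    next
      case (edge u v r)
      then have uv: "u \<noteq> v" and supp: "point_supp (\<eta> t) = {u, v}"
        using point_supp_edge[of u v r] E_neq[of u v] by auto
      have "\<forall>\<^sub>F s in at t within {a..b}. u \<in> point_supp (\<eta> s)"
        and "\<forall>\<^sub>F s in at t within {a..b}. v \<in> point_supp (\<eta> s)"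
        using eventually_in_point_supp[OF \<eta> t] supp by simp_all
      with in_ab show ?thesis
      proof eventually_elim
        case (elim s)
        then have sX: "\<eta> s \<in> X" using isometric_curve_in[OF \<eta>] by simp
        show ?case using point_supp_two[OF sX elim(2,3) uv] supp by simp
      qed
    qed
  qed
qed (use assms(2) in auto)

lemma dist_le_relpow:
  assumes "(u, v) \<in> E ^^ k" "u \<in> V"
  shows "v \<in> V \<and> d (vertex_point u) (vertex_point v) \<le> real k"
  using assms(1)
proof (induction k arbitrary: v)
  case 0
  then show ?case using assms(2) vertex_point_in_X by simp
next
  case (Suc k)
  then obtain w where w: "(u, w) \<in> E ^^ k" "(w, v) \<in> E" by auto
  then have "d (vertex_point w) (vertex_point v) = 1" using dist_edge[of w v 0 1] by simp
  then show ?case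
    using Suc.IH[OF w(1)] dist_triangle[of "vertex_point u" "vertex_point w" "vertex_point v"]
      E_V[OF w(2)] assms(2) vertex_point_in_X by auto
qed

text \<open>A shortest walk inside \<open>W\<close> repeats no vertex, since the loop between two
  visits could be cut out; with at most \<open>card W\<close> vertices it has at most
  \<open>card W - 1\<close> steps.\<close>

lemma dist_le_card_component:
  assumes "(u, v) \<in> (E \<inter> W \<times> W)\<^sup>*" "u \<in> W" "finite W" "W \<subseteq> V"
  shows "d (vertex_point u) (vertex_point v) \<le> real (card W) - 1"
proof -
  define R where "R = E \<inter> W \<times> W"
  define k where "k = (LEAST k. (u, v) \<in> R ^^ k)"
  have "\<exists>k. (u, v) \<in> R ^^ k" using assms(1) rtrancl_imp_relpow R_def by blast
  then have k: "(u, v) \<in> R ^^ k" unfolding k_def by (rule LeastI_ex)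
  have least: "k \<le> j" if "(u, v) \<in> R ^^ j" for j unfolding k_def using that by (rule Least_le)
  obtain f where f: "f 0 = u" "f k = v" "\<And>i. i < k \<Longrightarrow> (f i, f (Suc i)) \<in> R"
    using k unfolding relpow_fun_conv by blast
  have sub: "(f i, f (i + j)) \<in> R ^^ j" if "i + j \<le> k" for i j
    using that
  proof (induction j)
    case (Suc j)
    then have "(f i, f (i + j)) \<in> R ^^ j" "(f (i + j), f (i + Suc j)) \<in> R" using f(3)[of "i + j"] by auto
    then show ?case by (rule relpow_Suc_I)
  qed simp
  have "f i \<noteq> f j" if "i < j" "j \<le> k" for i j
  proof
    assume "f i = f j"
    then have "(f 0, f i) \<in> R ^^ i" "(f i, f k) \<in> R ^^ (k - j)"
      using sub[of 0 i] sub[of j "k - j"] that by simp_all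
    then have "(u, v) \<in> R ^^ (i + (k - j))" using f(1,2) by (auto simp: relpow_add)
    then show False using least[of "i + (k - j)"] that by simp
  qed
  then have "inj_on f {..k}" by (intro linorder_inj_onI) auto
  moreover have "f i \<in> W" if "i \<le> k" for i
    using f(1) f(3)[of "i - 1"] assms(2) that by (cases i) (auto simp: R_def)
  ultimately have "card {..k} \<le> card W" using assms(3) by (intro card_inj_on_le[of f]) auto
  moreover have "(u, v) \<in> E ^^ k" 
    unfolding relpow_fun_conv using f by (auto simp: R_def intro!: exI[of _ f])
  ultimately show ?thesis using dist_le_relpow[of u v k] assms(2,4) by auto
qed

text \<open>\<open>linked\<close> expresses that the ends are joined outside the open ball around
  the midpoint. Quantifying over labels lets several curves be chained without constructing a walk;
  a walk is recovered by applying it to one label, the \<open>f\<close> defined in the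
  proof.\<close>

lemma four_radius_le_card:
  assumes \<gamma>: "isometric_curve X d \<gamma> a b" and D: "b - a = 2 * D" "1 < 2 * D"
    and linked: "\<And>f :: 'a set \<Rightarrow> bool.
      (\<And>w w'. D \<le> d (\<gamma> ((a + b) / 2)) (vertex_point w) \<Longrightarrow> (w, w') \<in> E \<Longrightarrow> f {w} = f {w, w'}) \<Longrightarrow>
      f (point_supp (\<gamma> a)) = f (point_supp (\<gamma> b))"
  shows "4 * D \<le> real (card V)"
proof -
  define p where "p = \<gamma> ((a + b) / 2)"
  define Z where "Z = {v \<in> V. d p (vertex_point v) < D}"
  define W where "W = V - Z"
  define S where "S = {t. a < t \<and> t < b \<and> \<gamma> t \<in> vertex_point ` V}"
  define vert where "vert t = (SOME v. v \<in> V \<and> \<gamma> t = vertex_point v)" for t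
  have ab: "a < b" using D by simp
  have vert: "vert t \<in> V" "\<gamma> t = vertex_point (vert t)" if "\<gamma> t \<in> vertex_point ` V" for t
    using someI_ex[of "\<lambda>v. v \<in> V \<and> \<gamma> t = vertex_point v"] that unfolding vert_def by blast+
  have finV: "finite V" by (rule pair_finite_verts)
  have WV: "W \<subseteq> V" "finite W" "finite Z" "Z \<subseteq> V" using finV by (auto simp: W_def Z_def)
  have inj: "inj_on vert S"
  proof (rule inj_onI)
    fix s t assume st: "s \<in> S" "t \<in> S" "vert s = vert t"
    then have "\<gamma> s = \<gamma> t" using vert[of s] vert[of t] by (simp add: S_def)
    then have "\<bar>s - t\<bar> = 0"
      using isometric_curve_dist[OF \<gamma>, of s t] st isometric_curve_in[OF \<gamma>, of t] by (simp add: S_def)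
    then show "s = t" by simp
  qed
  have vertZ: "vert t \<in> Z" if "t \<in> S" for t
  proof -
    have "d p (\<gamma> t) = \<bar>(a + b) / 2 - t\<bar>"
      unfolding p_def using that D by (intro isometric_curve_dist[OF \<gamma>]) (auto simp: S_def)
    also have "\<dots> < D" using that D by (auto simp: S_def abs_less_iff field_simps)
    finally show ?thesis using that vert[of t] by (simp add: Z_def S_def)
  qed
  have finS: "finite S" using inj WV(3) vertZ by (rule_tac inj_on_finite[of vert S Z]) auto
  have cardS: "card S \<le> card Z" using inj WV(3) vertZ by (intro card_inj_on_le[of vert]) auto
  \<comment> \<open>Without a vertex the whole curve would lie in one edge, yet its length
    \<open>2 * D\<close> exceeds 1.\<close>
  have S_nonempty: "S \<noteq> {}"
  proof
    assume "S = {}"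
    then have "\<gamma> t \<notin> vertex_point ` V" if "a < t" "t < b" for t using that by (auto simp: S_def)
    then show False using isometric_curve_on_edge[OF \<gamma> ab] D by fastforce
  qed
  define t1 where "t1 = Min S"
  define t2 where "t2 = Max S"
  have t1: "t1 \<in> S" and t2: "t2 \<in> S" unfolding t1_def t2_def using finS S_nonempty by simp_all
  have t1b: "a < t1" "t1 < b" and t2b: "a < t2" "t2 < b" using t1 t2 by (auto simp: S_def)
  have before: "\<gamma> t \<notin> vertex_point ` V" if "a < t" "t < t1" for t
    using that Min_le[OF finS, of t] t1b by (auto simp: S_def t1_def)
  have after: "\<gamma> t \<notin> vertex_point ` V" if "t2 < t" "t < b" for t
    using that Max_ge[OF finS, of t] t2b by (auto simp: S_def t2_def)
  have end_of_edge: "r = 0 \<or> r = 1"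
    if "edge_point u v r \<in> vertex_point ` V" "(u, v) \<in> E" "0 \<le> r" "r \<le> 1" for u v r
  proof (rule ccontr)
    assume "\<not> ?thesis"
    then have "point_supp (edge_point u v r) = {u, v}" using that E_neq by (intro point_supp_edge) auto
    then show False using that E_neq by force
  qed
  \<comment> \<open>\<open>v0\<close> is the end of the first edge that points away from the curve,
    and \<open>\<tau>\<close> is the distance from \<open>\<gamma> a\<close> back to it;
    \<open>\<tau> = 0\<close> if the curve starts at a vertex.\<close>
  obtain v0 v1 \<tau> where e1: "(v0, v1) \<in> E" "0 \<le> \<tau>" "\<tau> + (t1 - a) \<le> 1"
    "\<And>t. a \<le> t \<Longrightarrow> t \<le> t1 \<Longrightarrow> \<gamma> t = edge_point v0 v1 (\<tau> + (t - a))"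
    by (rule isometric_curve_on_edge[of \<gamma> a t1]) (use isometric_curve_sub[OF \<gamma>] t1b before in auto)
  have "\<gamma> t1 = edge_point v0 v1 (\<tau> + (t1 - a))" using e1(4)[of t1] t1b by simp
  then have \<tau>: "\<tau> + (t1 - a) = 1"
    using end_of_edge[of v0 v1 "\<tau> + (t1 - a)"] e1 t1 t1b by (auto simp: S_def)
  then have "\<gamma> t1 = vertex_point v1" using e1(4)[of t1] t1b by simp
  then have v1: "v1 \<in> Z" using vertZ[OF t1] vert[of t1] t1 by (auto simp: S_def)
  have \<gamma>a: "\<gamma> a = edge_point v0 v1 \<tau>" using e1(4)[of a] t1b by simp
  obtain w1 w0 \<rho> where e2: "(w1, w0) \<in> E" "0 \<le> \<rho>" "\<rho> + (b - t2) \<le> 1"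
    "\<And>t. t2 \<le> t \<Longrightarrow> t \<le> b \<Longrightarrow> \<gamma> t = edge_point w1 w0 (\<rho> + (t - t2))"
    by (rule isometric_curve_on_edge[of \<gamma> t2 b]) (use isometric_curve_sub[OF \<gamma>] t2b after in auto)
  have "\<gamma> t2 = edge_point w1 w0 \<rho>" using e2(4)[of t2] t2b by simp
  then have \<rho>: "\<rho> = 0" using end_of_edge[of w1 w0 \<rho>] e2 t2 t2b by (auto simp: S_def)
  then have "\<gamma> t2 = vertex_point w1" using e2(4)[of t2] t2b by simp
  then have w1: "w1 \<in> Z" using vertZ[OF t2] vert[of t2] t2 by (auto simp: S_def)
  have \<gamma>b: "\<gamma> b = edge_point w1 w0 (b - t2)" using e2(4)[of b] t2b \<rho> by simp
  \<comment> \<open>Between consecutive vertex times the curve stays on one edge.\<close>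
  have "\<exists>t'\<in>S. t < t' \<and> t' \<le> t + 1" if t: "t \<in> S" "t \<noteq> Max S" for t
  proof (rule ccontr)
    assume none: "\<not> ?thesis"
    define t' where "t' = Min {s \<in> S. t < s}"
    have "t2 \<in> {s \<in> S. t < s}" using t t2 Max_ge[OF finS t(1)] by (auto simp: t2_def)
    then have "t' \<in> {s \<in> S. t < s}" unfolding t'_def using finS by (intro Min_in) auto
    then have t': "t' \<in> S" "t < t'" by simp_all
    have tab: "a < t" "t' < b" using t t' by (auto simp: S_def)
    have "\<gamma> s \<notin> vertex_point ` V" if "t < s" "s < t'" for s
    proof
      assume "\<gamma> s \<in> vertex_point ` V"
      then have "s \<in> {s \<in> S. t < s}" using that tab by (auto simp: S_def)
      then have "t' \<le> s" unfolding t'_def using finS by (intro Min_le) auto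
      then show False using that by simp
    qed
    then obtain u v \<sigma> where "0 \<le> \<sigma>" "\<sigma> + (t' - t) \<le> 1"
      using isometric_curve_on_edge[of \<gamma> t t'] isometric_curve_sub[OF \<gamma>, of t t'] tab t'(2)
      by (metis less_imp_le)
    then have "t' \<le> t + 1" by simp
    then show False using none t' by auto
  qed
  then have inner: "t2 - t1 \<le> real (card Z) - 1"
    using Max_minus_Min_le_card[OF finS S_nonempty] cardS by (simp add: t1_def t2_def)
  define comp where "comp = {w \<in> W. v0 \<in> W \<and> (v0, w) \<in> (E \<inter> W \<times> W)\<^sup>*}"
  \<comment> \<open>The second clause matters if \<open>v0\<close> lies in the ball: then
    \<open>comp\<close> is empty, and the label still has to hold at the start, which is an inner
    point of the edge \<open>v0 v1\<close>.\<close>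
  define f where "f A \<longleftrightarrow> A \<inter> comp \<noteq> {} \<or> A = {v0, v1}" for A
  have compW: "comp \<subseteq> W" by (auto simp: comp_def)
  have far: "w \<in> W \<longleftrightarrow> D \<le> d p (vertex_point w)" if "w \<in> V" for w
    using that by (auto simp: W_def Z_def)
  have "f {w} = f {w, w'}" if "D \<le> d p (vertex_point w)" "(w, w') \<in> E" for w w'
  proof (cases "w \<in> comp")
    case False
    have w: "w \<in> W" using far E_V(1)[OF that(2)] that(1) by simp
    then have "w \<noteq> v1" using v1 by (auto simp: W_def)
    moreover have "w \<noteq> v0" using False w by (auto simp: comp_def)
    moreover have "w' \<notin> comp"
    proof
      assume "w' \<in> comp"
      then have "(v0, w) \<in> (E \<inter> W \<times> W)\<^sup>*"
        using w E_sym[OF that(2)] by (auto simp: comp_def intro: rtrancl_into_rtrancl)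
      then show False using False w \<open>w' \<in> comp\<close> by (auto simp: comp_def)
    qed
    ultimately show ?thesis using False E_neq[OF e1(1)] E_neq[OF that(2)] by (auto simp: f_def)
  qed (simp add: f_def)
  then have "f (point_supp (\<gamma> a)) = f (point_supp (\<gamma> b))" by (intro linked) (simp add: p_def)
  moreover have "f (point_supp (\<gamma> a))"
  proof (cases "\<tau> = 0")
    case True
    then have "\<gamma> a = vertex_point v0" using \<gamma>a by simp
    moreover have "d p (\<gamma> a) = D"
      unfolding p_def using isometric_curve_dist[OF \<gamma>, of "(a + b) / 2" a] D by simp
    ultimately have "v0 \<in> W" using far E_V(1)[OF e1(1)] by simp
    then show ?thesis using \<open>\<gamma> a = vertex_point v0\<close> by (auto simp: f_def comp_def)
  next
    case False
    then show ?thesis using \<gamma>a \<tau> t1b e1 E_neq point_supp_edge[of v0 v1 \<tau>] by (auto simp: f_def)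
  qed
  moreover have bsupp: "point_supp (\<gamma> b) \<subseteq> {w1, w0}"
    unfolding \<gamma>b by (auto simp: point_supp_def edge_point_def vertex_point_def split: if_splits)
  \<comment> \<open>Two points of one edge are at most 1 apart, while the ends of the curve have
    distance \<open>2 * D\<close>.\<close>
  moreover have "point_supp (\<gamma> b) \<noteq> {v0, v1}"
  proof
    assume eq: "point_supp (\<gamma> b) = {v0, v1}"
    then have "\<gamma> b = edge_point v0 v1 (\<gamma> b v1)" "0 < \<gamma> b v1" "\<gamma> b v1 < 1"
      using point_supp_two[of "\<gamma> b" v0 v1] isometric_curve_in[OF \<gamma>, of b] ab E_neq[OF e1(1)] by auto
    then have "d (\<gamma> a) (\<gamma> b) = \<bar>\<tau> - \<gamma> b v1\<bar>"
      using dist_edge[OF e1(1), of \<tau> "\<gamma> b v1"] \<gamma>a \<tau> t1b e1(2) by simp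
    then show False
      using isometric_curve_dist[OF \<gamma>, of a b] ab D \<open>0 < \<gamma> b v1\<close> \<open>\<gamma> b v1 < 1\<close> \<tau> e1(2) t1b by simp
  qed
  ultimately have "w1 \<in> comp \<or> w0 \<in> comp" unfolding f_def by blast
  then have "w0 \<in> comp" using w1 compW by (auto simp: W_def)
  then have outer: "d (vertex_point v0) (vertex_point w0) \<le> real (card W) - 1"
    using WV by (intro dist_le_card_component) (auto simp: comp_def)
  have "2 * D = d (\<gamma> a) (\<gamma> b)" using isometric_curve_dist[OF \<gamma>, of a b] ab D by simp
  also have "\<dots> \<le> d (\<gamma> a) (vertex_point v0) + d (vertex_point v0) (\<gamma> b)"
    using isometric_curve_in[OF \<gamma>] ab vertex_point_in_X E_V[OF e1(1)] by (intro dist_triangle) auto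
  also have "d (vertex_point v0) (\<gamma> b) \<le> d (vertex_point v0) (vertex_point w0) + d (vertex_point w0) (\<gamma> b)"
    using isometric_curve_in[OF \<gamma>] ab vertex_point_in_X E_V[OF e1(1)] E_V[OF e2(1)]
    by (intro dist_triangle) auto
  also have "d (\<gamma> a) (vertex_point v0) = \<tau>"
    using dist_edge[OF e1(1), of \<tau> 0] \<gamma>a \<tau> t1b e1 by simp
  also have "d (vertex_point w0) (\<gamma> b) = 1 - (b - t2)"
    using dist_edge[OF e2(1), of 1 "b - t2"] \<gamma>b \<rho> t2b e2 by simp
  finally have "2 * D \<le> \<tau> + (real (card W) - 1) + (1 - (b - t2))" using outer by linarith
  moreover have "card V = card Z + card W"
    using card_Diff_subset[OF WV(3,4)] card_mono[OF finV WV(4)] by (simp add: W_def)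
  \<comment> \<open>As \<open>t1 - a = 1 - \<tau>\<close>, the inner estimate reads
    \<open>2 * D \<le> (1 - \<tau>) + (card Z - 1) + (b - t2)\<close>; adding the outer one leaves
    exactly \<open>card Z + card W\<close>.\<close>
  ultimately show ?thesis using inner \<tau> D by simp
qed

end

section \<open>Bounds for geodesic triangles\<close>

lemma is_geodesicE:
  assumes "is_geodesic M d x y S"
  obtains L \<gamma> where "0 \<le> L" "isometric_curve M d \<gamma> 0 L" "\<gamma> 0 = x" "\<gamma> L = y" "S = \<gamma> ` {0..L}"
  using assms by (auto simp: is_geodesic_def isometric_curve_def)

lemma is_geodesicI:
  assumes "0 \<le> L" "isometric_curve M d \<gamma> 0 L" "\<gamma> 0 = x" "\<gamma> L = y" "S = \<gamma> ` {0..L}"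
  shows "is_geodesic M d x y S"
  using assms unfolding is_geodesic_def isometric_curve_def by blast

lemma is_geodesic_triangle_rotate:
  "is_geodesic_triangle M d (A, B, C) \<Longrightarrow> is_geodesic_triangle M d (B, C, A)"
  by (auto simp: is_geodesic_triangle_def)

lemma thin_triangleI:
  assumes T: "is_geodesic_triangle M d T"
    and side: "\<And>A B C p. is_geodesic_triangle M d (A, B, C) \<Longrightarrow> p \<in> A \<Longrightarrow> dist_to_set d p (B \<union> C) \<le> \<delta>"
  shows "thin_triangle d \<delta> T"
proof -
  obtain A B C where ABC: "T = (A, B, C)" by (cases T)
  show ?thesis
    using side[of A B C] side[of B C A] side[of C A B] T
      is_geodesic_triangle_rotate[of M d A B C] is_geodesic_triangle_rotate[of M d B C A]
    by (simp add: ABC thin_triangle_def)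
qed

lemma triangle_thinness_le: "0 \<le> \<delta> \<Longrightarrow> thin_triangle d \<delta> T \<Longrightarrow> triangle_thinness d T \<le> \<delta>"
  unfolding triangle_thinness_def by (intro cInf_lower bdd_belowI[of _ 0]) auto

lemma triangle_thinness_ge:
  assumes "thin_triangle d \<delta> (A, B, C)" "0 \<le> \<delta>" "p \<in> A"
  shows "dist_to_set d p (B \<union> C) \<le> triangle_thinness d (A, B, C)"
  unfolding triangle_thinness_def
  by (rule cInf_greatest) (use assms in \<open>auto simp: thin_triangle_def\<close>)

lemma hyperbolicity_le:
  assumes "is_geodesic_triangle M d T0" "0 \<le> \<delta>"
    and "\<And>T. is_geodesic_triangle M d T \<Longrightarrow> thin_triangle d \<delta> T"
  shows "hyperbolicity M d \<le> \<delta>"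
  unfolding hyperbolicity_def
proof (rule cSUP_least)
  show "{T. is_geodesic_triangle M d T} \<noteq> {}" using assms(1) by blast
  fix T assume "T \<in> {T. is_geodesic_triangle M d T}"
  then show "triangle_thinness d T \<le> \<delta>" using triangle_thinness_le[OF assms(2,3)] by simp
qed

text \<open>A real supremum dominates its members if the family is bounded above, so a bound from
  below on the hyperbolicity constant also calls for a uniform bound \<open>\<delta>\<close> on all
  triangles.\<close>

lemma hyperbolicity_ge:
  assumes "is_geodesic_triangle M d (A, B, C)" "p \<in> A" "0 \<le> \<delta>"
    and thin: "\<And>T. is_geodesic_triangle M d T \<Longrightarrow> thin_triangle d \<delta> T"
  shows "dist_to_set d p (B \<union> C) \<le> hyperbolicity M d"
proof -
  have "dist_to_set d p (B \<union> C) \<le> triangle_thinness d (A, B, C)"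
    using assms by (intro triangle_thinness_ge) auto
  also have "\<dots> \<le> hyperbolicity M d"
    unfolding hyperbolicity_def
  proof (rule cSUP_upper)
    show "bdd_above (triangle_thinness d ` {T. is_geodesic_triangle M d T})"
    proof (rule bdd_aboveI2)
      fix T assume "T \<in> {T. is_geodesic_triangle M d T}"
      then show "triangle_thinness d T \<le> \<delta>" using triangle_thinness_le[OF assms(3) thin] by simp
    qed
  qed (use assms(1) in simp)
  finally show ?thesis .
qed

section \<open>Number of edges of a connected graph\<close>

definition edge_set :: "('a \<times> 'a) set \<Rightarrow> 'a set set" where
  "edge_set R = {{u, v} |u v. (u, v) \<in> R}"

lemma edge_set_image: "edge_set R = (\<lambda>(u, v). {u, v}) ` R"
  by (auto simp: edge_set_def)

text \<open>Sending each vertex other than the root to the last edge of a shortest walk from the root is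
  injective.\<close>

lemma card_le_Suc_card_edge_set:
  assumes "finite V" "finite R" "r \<in> V" "\<And>v. v \<in> V \<Longrightarrow> (r, v) \<in> R\<^sup>*"
  shows "card V \<le> Suc (card (edge_set R))"
proof -
  define \<delta> where "\<delta> v = (LEAST k. (r, v) \<in> R ^^ k)" for v
  have "\<exists>u. (u, v) \<in> R \<and> \<delta> u < \<delta> v" if "v \<in> V - {r}" for v
  proof -
    have "\<exists>k. (r, v) \<in> R ^^ k" using assms(4) that rtrancl_imp_relpow by blast
    then have k: "(r, v) \<in> R ^^ \<delta> v" unfolding \<delta>_def by (rule LeastI_ex)
    have "\<delta> v \<noteq> 0"
    proof
      assume "\<delta> v = 0"
      then show False using k that by simp
    qed
    then obtain j where j: "\<delta> v = Suc j" by (cases "\<delta> v") auto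
    then obtain u where "(r, u) \<in> R ^^ j" "(u, v) \<in> R" using k by auto
    moreover from this have "\<delta> u \<le> j" unfolding \<delta>_def by (intro Least_le)
    ultimately show ?thesis using j by auto
  qed
  then obtain par where par: "\<And>v. v \<in> V - {r} \<Longrightarrow> (par v, v) \<in> R \<and> \<delta> (par v) < \<delta> v" by metis
  have "inj_on (\<lambda>v. {par v, v}) (V - {r})"
  proof (rule inj_onI)
    fix v w assume vw: "v \<in> V - {r}" "w \<in> V - {r}" "{par v, v} = {par w, w}"
    show "v = w"
    proof (rule ccontr)
      assume "v \<noteq> w"
      then have "v = par w" "w = par v" using vw(3) by (auto simp: doubleton_eq_iff)
      then show False using par[OF vw(1)] par[OF vw(2)] by simp
    qed
  qed
  moreover have "(\<lambda>v. {par v, v}) ` (V - {r}) \<subseteq> edge_set R" using par by (auto simp: edge_set_def)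
  moreover have "finite (edge_set R)" using assms(2) by (simp add: edge_set_image)
  ultimately have "card (V - {r}) \<le> card (edge_set R)" by (intro card_inj_on_le) auto
  then show ?thesis using assms(1,3) by simp
qed

context connected_pair_graph
begin

text \<open>Provides a member of the set of triangles, over which the supremum is taken.\<close>

lemma degenerate_triangle:
  assumes "x \<in> X"
  shows "is_geodesic_triangle X d ({x}, {x}, {x})"
proof -
  have "is_geodesic X d x x {x}"
    by (rule is_geodesicI[of 0 _ _ "\<lambda>_. x"]) (use assms in \<open>auto simp: isometric_curve_def\<close>)
  then show ?thesis using assms by (auto simp: is_geodesic_triangle_def)
qed

lemma ex_point: "\<exists>x. x \<in> X"
  using V_nonempty vertex_point_in_X by blast

lemma dist_to_set_le:
  assumes "p \<in> X" "S \<subseteq> X" "q \<in> S"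
  shows "dist_to_set d p S \<le> d p q"
  unfolding dist_to_set_def
  using assms dist_nonneg by (intro cINF_lower bdd_belowI2[of _ 0]) auto

lemma dist_to_set_card:
  assumes T: "is_geodesic_triangle X d (A, B, C)" and p: "p \<in> A" and n: "3 \<le> card V"
  shows "dist_to_set d p (B \<union> C) \<le> real (card V) / 4"
proof (rule ccontr)
  assume neg: "\<not> ?thesis"
  define D where "D = dist_to_set d p (B \<union> C)"
  have D: "real (card V) < 4 * D" using neg by (simp add: D_def)
  obtain x1 x2 x3 where geo: "is_geodesic X d x1 x2 A" "is_geodesic X d x2 x3 B" "is_geodesic X d x3 x1 C"
    using T by (auto simp: is_geodesic_triangle_def)
  obtain L \<gamma> where A: "0 \<le> L" "isometric_curve X d \<gamma> 0 L" "\<gamma> 0 = x1" "\<gamma> L = x2" "A = \<gamma> ` {0..L}"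
    using geo(1) by (rule is_geodesicE)
  obtain LB \<beta> where B: "0 \<le> LB" "isometric_curve X d \<beta> 0 LB" "\<beta> 0 = x2" "\<beta> LB = x3" "B = \<beta> ` {0..LB}"
    using geo(2) by (rule is_geodesicE)
  obtain LC \<eta> where C: "0 \<le> LC" "isometric_curve X d \<eta> 0 LC" "\<eta> 0 = x3" "\<eta> LC = x1" "C = \<eta> ` {0..LC}"
    using geo(3) by (rule is_geodesicE)
  obtain s0 where s0: "0 \<le> s0" "s0 \<le> L" "p = \<gamma> s0" using p A(5) by auto
  have BC: "B \<subseteq> X" "C \<subseteq> X" using B C by (auto simp: isometric_curve_def)
  have pX: "p \<in> X" using isometric_curve_in[OF A(2)] s0 by simp
  have far: "D \<le> d p q" if "q \<in> B \<union> C" for q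
    using dist_to_set_le[OF pX _ that] BC by (simp add: D_def)
  \<comment> \<open>The ends of the side belong to the other two sides, so they are at distance at
    least \<open>D\<close> from \<open>p\<close>, and the piece from \<open>s0 - D\<close> to
    \<open>s0 + D\<close> exists.\<close>
  have "x1 \<in> C" "x2 \<in> B" using B C by force+
  then have "D \<le> d p (\<gamma> 0)" "D \<le> d p (\<gamma> L)" using far A by auto
  then have sD: "D \<le> s0" "D \<le> L - s0" using isometric_curve_dist[OF A(2)] s0 A(1) by auto
  \<comment> \<open>\<open>card V < 4 * D\<close> with at least three vertices gives
    \<open>2 * D > 3 / 2\<close>.\<close>
  have D0: "0 \<le> D" "1 < 2 * D" using D n by auto
  have "4 * D \<le> real (card V)"
  proof (rule four_radius_le_card[of \<gamma> "s0 - D" "s0 + D"])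
    show "isometric_curve X d \<gamma> (s0 - D) (s0 + D)"
      using sD by (intro isometric_curve_sub[OF A(2)]) auto
    fix f :: "'a set \<Rightarrow> bool"
    assume "\<And>w w'. D \<le> d (\<gamma> ((s0 - D + (s0 + D)) / 2)) (vertex_point w) \<Longrightarrow> (w, w') \<in> E \<Longrightarrow> f {w} = f {w, w'}"
    then have f: "f {w} = f {w, w'}" if "D \<le> d p (vertex_point w)" "(w, w') \<in> E" for w w'
      using that s0 by simp
    have const: "f (point_supp (\<zeta> a)) = f (point_supp (\<zeta> b))"
      if "isometric_curve X d \<zeta> a b" "a \<le> b" "\<And>t. a \<le> t \<Longrightarrow> t \<le> b \<Longrightarrow> D \<le> d p (\<zeta> t)" for \<zeta> a b
      using that(1,2)
    proof (rule curve_label_const)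
      fix t w w' assume "a \<le> t" "t \<le> b" "\<zeta> t = vertex_point w" "(w, w') \<in> E"
      then show "f {w} = f {w, w'}" using that(3)[of t] f by simp
    qed
    \<comment> \<open>The label is carried from \<open>s0 - D\<close> back to \<open>x1\<close>,
      along the other two sides to \<open>x2\<close>, and from there to \<open>s0 + D\<close>; all
      these curves avoid the open ball.\<close>
    have "f (point_supp (\<gamma> 0)) = f (point_supp (\<gamma> (s0 - D)))"
      using sD s0 D0 by (intro const isometric_curve_sub[OF A(2)])
        (auto simp: isometric_curve_dist[OF A(2)])
    moreover have "f (point_supp (\<gamma> (s0 + D))) = f (point_supp (\<gamma> L))"
      using sD s0 D0 by (intro const isometric_curve_sub[OF A(2)])
        (auto simp: isometric_curve_dist[OF A(2)])
    moreover have "f (point_supp x2) = f (point_supp x3)"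
      using const[OF B(2,1)] far B by auto
    moreover have "f (point_supp x3) = f (point_supp x1)"
      using const[OF C(2,1)] far C by auto
    ultimately show "f (point_supp (\<gamma> (s0 - D))) = f (point_supp (\<gamma> (s0 + D)))" using A by simp
  qed (use D0 in auto)
  then show False using D by simp
qed

lemma thin_card: "3 \<le> card V \<Longrightarrow> is_geodesic_triangle X d T \<Longrightarrow> thin_triangle d (real (card V) / 4) T"
  by (rule thin_triangleI) (blast intro: dist_to_set_card)+

lemma graph_hyperbolicity_le_card: "3 \<le> card V \<Longrightarrow> graph_hyperbolicity G \<le> real (card V) / 4"
  unfolding graph_hyperbolicity_def
  using degenerate_triangle ex_point thin_card by (metis hyperbolicity_le divide_nonneg_pos of_nat_0_le_iff zero_less_numeral)

lemma dist_to_set_le_hyperbolicity: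
  assumes "3 \<le> card V" "is_geodesic_triangle X d (A, B, C)" "p \<in> A"
  shows "dist_to_set d p (B \<union> C) \<le> graph_hyperbolicity G"
  unfolding graph_hyperbolicity_def
  using assms thin_card by (intro hyperbolicity_ge[of _ _ _ _ _ _ "real (card V) / 4"]) auto

text \<open>The total weight of a point on one side of a bridge is a continuous function, and inside
  the bridge its level sets are single points.\<close>

lemma dist_to_set_bridges:
  assumes T: "is_geodesic_triangle X d (A, B, C)" and p: "p \<in> A"
    and bridge: "\<And>u v. (u, v) \<in> E \<Longrightarrow> (v, u) \<notin> (E - {(u, v), (v, u)})\<^sup>*"
  shows "dist_to_set d p (B \<union> C) \<le> 0"
proof (rule ccontr)
  assume neg: "\<not> ?thesis"
  define D where "D = dist_to_set d p (B \<union> C)"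
  have D: "0 < D" using neg by (simp add: D_def)
  obtain x1 x2 x3 where geo: "is_geodesic X d x1 x2 A" "is_geodesic X d x2 x3 B" "is_geodesic X d x3 x1 C"
    using T by (auto simp: is_geodesic_triangle_def)
  obtain L \<gamma> where A: "0 \<le> L" "isometric_curve X d \<gamma> 0 L" "\<gamma> 0 = x1" "\<gamma> L = x2" "A = \<gamma> ` {0..L}"
    using geo(1) by (rule is_geodesicE)
  obtain LB \<beta> where B: "0 \<le> LB" "isometric_curve X d \<beta> 0 LB" "\<beta> 0 = x2" "\<beta> LB = x3" "B = \<beta> ` {0..LB}"
    using geo(2) by (rule is_geodesicE)
  obtain LC \<eta> where C: "0 \<le> LC" "isometric_curve X d \<eta> 0 LC" "\<eta> 0 = x3" "\<eta> LC = x1" "C = \<eta> ` {0..LC}"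
    using geo(3) by (rule is_geodesicE)
  obtain s0 where s0: "0 \<le> s0" "s0 \<le> L" "p = \<gamma> s0" using p A(5) by auto
  have BC: "B \<subseteq> X" "C \<subseteq> X" using B C by (auto simp: isometric_curve_def)
  have pX: "p \<in> X" using isometric_curve_in[OF A(2)] s0 by simp
  have far: "D \<le> d p q" if "q \<in> B \<union> C" for q
    using dist_to_set_le[OF pX _ that] BC by (simp add: D_def)
  have "x1 \<in> C" "x2 \<in> B" using B C by force+
  then have "D \<le> d p (\<gamma> 0)" "D \<le> d p (\<gamma> L)" using far A by auto
  then have sD: "D \<le> s0" "D \<le> L - s0" using isometric_curve_dist[OF A(2)] s0 A(1) by auto
  define \<epsilon> where "\<epsilon> = min (D / 2) (1 / 2)"
  have \<epsilon>: "0 < \<epsilon>" "\<epsilon> \<le> D / 2" "\<epsilon> < 1" using D by (auto simp: \<epsilon>_def)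
  \<comment> \<open>The point \<open>p\<close> may be a vertex. Distinct vertices are at distance at
    least 1, so one of two times less than 1 apart gives an inner point of an edge; a shift of at
    most \<open>D / 2\<close> keeps it off the other sides.\<close>
  have "\<gamma> s0 \<notin> vertex_point ` V \<or> \<gamma> (s0 + \<epsilon>) \<notin> vertex_point ` V"
  proof (rule ccontr)
    assume "\<not> ?thesis"
    then obtain v w where vw: "\<gamma> s0 = vertex_point v" "\<gamma> (s0 + \<epsilon>) = vertex_point w" by blast
    have dist: "d (\<gamma> s0) (\<gamma> (s0 + \<epsilon>)) = \<epsilon>"
      using isometric_curve_dist[OF A(2)] s0 \<epsilon> sD by simp
    moreover have X2: "\<gamma> s0 \<in> X" "\<gamma> (s0 + \<epsilon>) \<in> X"
      using isometric_curve_in[OF A(2)] s0 \<epsilon> sD by simp_all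
    ultimately have "v \<noteq> w" using vw \<epsilon> by auto
    then show False
      using coordinate_le_dist[OF X2, of v] vw dist \<epsilon> by (simp add: vertex_point_def)
  qed
  then obtain s where s: "\<gamma> s \<notin> vertex_point ` V" "s0 \<le> s" "s \<le> s0 + D / 2" using \<epsilon> D
    by (metis add_increasing2 add_left_mono le_add_same_cancel1 less_imp_le order_refl half_gt_zero)
  have s0L: "0 < s" "s < L" using s sD D by auto
  have sX: "\<gamma> s \<in> X" using isometric_curve_in[OF A(2)] s0L by simp
  have notin: "\<gamma> s \<notin> B \<union> C"
  proof
    assume "\<gamma> s \<in> B \<union> C"
    then show False using far isometric_curve_dist[OF A(2), of s0 s] s s0 s0L D by fastforce
  qed
  obtain a b r0 where e0: "(a, b) \<in> E" "0 < r0" "r0 < 1" "\<gamma> s = edge_point a b r0"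
    using sX s(1) by (cases rule: X_cases) auto
  \<comment> \<open>For a time shorter than \<open>r\<close> in either direction the curve neither
    ends nor reaches a vertex.\<close>
  define r where "r = min (min r0 (1 - r0)) (min s (L - s))"
  have r: "0 < r" "r \<le> r0" "r \<le> 1 - r0" "r \<le> s" "r \<le> L - s" using e0 s0L by (auto simp: r_def)
  have sub: "isometric_curve X d \<gamma> (s - r) (s + r)" using r by (intro isometric_curve_sub[OF A(2)]) auto
  have nonvertex: "\<gamma> t \<notin> vertex_point ` V" if "s - r < t" "t < s + r" for t
  proof
    assume "\<gamma> t \<in> vertex_point ` V"
    then obtain w where w: "\<gamma> t = vertex_point w" by blast
    have "\<bar>\<gamma> s b - \<gamma> t b\<bar> < r"
      using coordinate_le_dist[of "\<gamma> s" "\<gamma> t" b] isometric_curve_dist[OF sub, of s t]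
        isometric_curve_in[OF sub] that by fastforce
    then show False using w e0 E_neq[OF e0(1)] r
      by (auto simp: edge_point_right vertex_point_def split: if_splits)
  qed
  have "s - r < s + r" using r by simp
  then obtain u v \<sigma> where e: "(u, v) \<in> E" "0 \<le> \<sigma>" "\<sigma> + (s + r - (s - r)) \<le> 1"
    "\<And>t. s - r \<le> t \<Longrightarrow> t \<le> s + r \<Longrightarrow> \<gamma> t = edge_point u v (\<sigma> + (t - (s - r)))"
    using isometric_curve_on_edge[OF sub _ nonvertex] by metis
  define \<tau> where "\<tau> = \<sigma> + r"
  have \<tau>: "0 < \<tau>" "\<tau> < 1" using e r by (auto simp: \<tau>_def)
  have \<gamma>s: "\<gamma> s = edge_point u v \<tau>" "\<gamma> (s - r) = edge_point u v \<sigma>" "\<gamma> (s + r) = edge_point u v (\<tau> + r)"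
    using e(4)[of s] e(4)[of "s - r"] e(4)[of "s + r"] r by (simp_all add: \<tau>_def add.assoc)
  define R where "R = E - {(u, v), (v, u)}"
  define W where "W = {w \<in> V. (v, w) \<in> R\<^sup>*}"
  define H where "H P = (\<Sum>w\<in>W. P w)" for P :: "'a \<Rightarrow> real"
  have finW: "finite W" using pair_finite_verts by (simp add: W_def)
  have "u \<notin> W" "v \<in> W" using bridge[OF e(1)] E_V[OF e(1)] by (auto simp: W_def R_def)
  have H_edge: "H (edge_point a b t) = (1 - t) * of_bool (a \<in> W) + t * of_bool (b \<in> W)" for a b t
    using finW by (simp add: H_def edge_point_def vertex_point_def sum.distrib sum.delta
        flip: sum_distrib_left)
  have same_side: "a \<in> W \<longleftrightarrow> b \<in> W" if "(a, b) \<in> E" "{a, b} \<noteq> {u, v}" for a b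
  proof -
    have "(a, b) \<in> R" "(b, a) \<in> R" using that E_sym[OF that(1)] by (auto simp: R_def)
    then show ?thesis using E_V[OF that(1)] by (auto simp: W_def intro: rtrancl_into_rtrancl)
  qed
  have level: "P = \<gamma> s" if "P \<in> X" "H P = \<tau>" for P
    using that(1)
  proof (cases rule: X_cases)
    case (vertex w)
    then show ?thesis using that(2) H_edge[of w w 0] \<tau> by (auto simp: of_bool_def split: if_splits)
  next
    case (edge a b t)
    show ?thesis
    proof (cases "{a, b} = {u, v}")
      case True
      then consider "a = u" "b = v" | "a = v" "b = u" by (auto simp: doubleton_eq_iff)
      then show ?thesis
      proof cases
        case 1
        then have "t = \<tau>" using H_edge[of a b t] edge that(2) \<open>u \<notin> W\<close> \<open>v \<in> W\<close> by simp
        then show ?thesis using 1 edge \<gamma>s by simp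
      next
        case 2
        then have "1 - t = \<tau>" using H_edge[of a b t] edge that(2) \<open>u \<notin> W\<close> \<open>v \<in> W\<close> by simp
        then show ?thesis using 2 edge \<gamma>s edge_point_swap[of v u t] by simp
      qed
    next
      case False
      then show ?thesis using same_side[OF edge(1) False] that(2) edge(4) H_edge[of a b t] \<tau>
        by (auto simp: of_bool_def split: if_splits)
    qed
  qed
  have cont: "continuous_on {t1..t2} (\<lambda>t. H (\<zeta> t))" if "isometric_curve X d \<zeta> t1 t2" for \<zeta> t1 t2
    unfolding H_def using isometric_curve_coordinate_continuous[OF that] by (intro continuous_on_sum)
  have H_ends: "H (\<gamma> (s - r)) < \<tau>" "\<tau> < H (\<gamma> (s + r))"
    using \<gamma>s H_edge[of u v] \<open>u \<notin> W\<close> \<open>v \<in> W\<close> r by (simp_all add: \<tau>_def)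
  have only: "t = s" if "0 \<le> t" "t \<le> L" "H (\<gamma> t) = \<tau>" for t
  proof -
    have "\<gamma> t = \<gamma> s" using level isometric_curve_in[OF A(2)] that by blast
    then have "\<bar>t - s\<bar> = 0" using isometric_curve_dist[OF A(2), of t s] that s0L sX by simp
    then show ?thesis by simp
  qed
  \<comment> \<open>Otherwise \<open>H\<close> would take the value \<open>\<tau>\<close> at some
    time up to \<open>s - r\<close>, whereas on this side of the triangle it does so only at
    \<open>s\<close>.\<close>
  have x1: "H x1 < \<tau>"
  proof (rule ccontr)
    assume "\<not> ?thesis"
    then obtain t where "0 \<le> t" "t \<le> s - r" "H (\<gamma> t) = \<tau>"
      using IVT2'[of "\<lambda>t. H (\<gamma> t)" "s - r" \<tau> 0] cont[OF isometric_curve_sub[OF A(2)], of 0 "s - r"]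
        H_ends A(3) r s0L by auto
    then show False using only[of t] r s0L by auto
  qed
  have x2: "\<tau> < H x2"
  proof (rule ccontr)
    assume "\<not> ?thesis"
    then obtain t where "s + r \<le> t" "t \<le> L" "H (\<gamma> t) = \<tau>"
      using IVT2'[of "\<lambda>t. H (\<gamma> t)" L \<tau> "s + r"] cont[OF isometric_curve_sub[OF A(2)], of "s + r" L]
        H_ends A(4) r s0L by auto
    then show False using only[of t] r s0L by auto
  qed
  show False
  \<comment> \<open>Wherever \<open>H x3\<close> lies, one of the other two sides joins values on
    both sides of \<open>\<tau>\<close> and therefore contains \<open>\<gamma> s\<close>.\<close>
  proof (cases "\<tau> \<le> H x3")
    case True
    then obtain t where "0 \<le> t" "t \<le> LC" "H (\<eta> t) = \<tau>"
      using IVT2'[of "\<lambda>t. H (\<eta> t)" LC \<tau> 0] cont[OF C(2)] x1 C by auto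
    then have "\<eta> t \<in> C" "\<eta> t = \<gamma> s" using level isometric_curve_in[OF C(2)] C(5) by auto
    then show False using notin by simp
  next
    case False
    then obtain t where "0 \<le> t" "t \<le> LB" "H (\<beta> t) = \<tau>"
      using IVT2'[of "\<lambda>t. H (\<beta> t)" LB \<tau> 0] cont[OF B(2)] x2 B by auto
    then have "\<beta> t \<in> B" "\<beta> t = \<gamma> s" using level isometric_curve_in[OF B(2)] B(5) by auto
    then show False using notin by simp
  qed
qed

text \<open>Deleting an edge that is not a bridge keeps the graph connected but leaves
  \<open>card V - 2\<close> edges, one too few for \<open>card_le_Suc_card_edge_set\<close>.\<close>

lemma tree_edges_are_bridges:
  assumes "card (edge_set E) = card V - 1" "(u, v) \<in> E"
  shows "(v, u) \<notin> (E - {(u, v), (v, u)})\<^sup>*"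
proof
  define R where "R = E - {(u, v), (v, u)}"
  assume "(v, u) \<in> (E - {(u, v), (v, u)})\<^sup>*"
  then have vu: "(v, u) \<in> R\<^sup>*" by (simp add: R_def)
  have "sym R" using E_sym by (auto simp: R_def sym_def)
  then have "(u, v) \<in> R\<^sup>*" using vu by (metis sym_rtrancl symD)
  then have "E \<subseteq> R\<^sup>*" using vu by (auto simp: R_def)
  then have "E\<^sup>* \<subseteq> R\<^sup>*" by (metis rtrancl_idemp rtrancl_mono)
  moreover have "u \<in> V" using E_V[OF assms(2)] by simp
  ultimately have "card V \<le> Suc (card (edge_set R))"
    using pair_finite_verts pair_finite_arcs E_rtrancl
    by (intro card_le_Suc_card_edge_set[of V R u]) (auto simp: R_def)
  moreover have "edge_set R \<subset> edge_set E"
  proof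
    show "edge_set R \<subseteq> edge_set E" by (auto simp: edge_set_def R_def)
    have "{u, v} \<in> edge_set E" "{u, v} \<notin> edge_set R"
      using assms(2) by (auto simp: edge_set_def R_def doubleton_eq_iff)
    then show "edge_set R \<noteq> edge_set E" by blast
  qed
  then have "card (edge_set R) < card (edge_set E)"
    using pair_finite_arcs by (intro psubset_card_mono) (simp_all add: edge_set_image)
  ultimately show False using assms(1) \<open>u \<in> V\<close> pair_finite_verts by (simp add: card_gt_0_iff)
qed

lemma graph_hyperbolicity_tree:
  assumes "card (edge_set E) = card V - 1"
  shows "graph_hyperbolicity G = 0"
proof -
  have thin: "thin_triangle d 0 T" if "is_geodesic_triangle X d T" for T
    using that by (rule thin_triangleI) (rule dist_to_set_bridges; use tree_edges_are_bridges[OF assms] in blast)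
  obtain x where x: "x \<in> X" using ex_point by blast
  have "graph_hyperbolicity G \<le> 0"
    unfolding graph_hyperbolicity_def using degenerate_triangle[OF x] thin by (intro hyperbolicity_le) auto
  moreover have "0 \<le> graph_hyperbolicity G"
    unfolding graph_hyperbolicity_def
    using hyperbolicity_ge[OF degenerate_triangle[OF x] _ _ thin, of x] x by (simp add: dist_to_set_def)
  ultimately show ?thesis by simp
qed

end

section \<open>Triangles on a cycle\<close>

text \<open>On an edge \<open>uv\<close> the extension is \<open>min (h u + t) (h v + 1 - t)\<close>, like the distance from a fixed
  vertex.\<close>

definition extend_potential :: "('a \<Rightarrow> real) \<Rightarrow> ('a \<Rightarrow> real) \<Rightarrow> real" where
  "extend_potential h P = Min ((\<lambda>w. h w + 1 - P w) ` point_supp P)"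

lemma extend_potential_vertex [simp]: "extend_potential h (vertex_point v) = h v"
  by (simp add: extend_potential_def) (simp add: vertex_point_def)

text \<open>The curve is at \<open>c i\<close> at the integer time \<open>i\<close>. Indices in
  \<open>int\<close> permit negative times, as needed for a start at the midpoint of the edge before
  \<open>c 0\<close>.\<close>

definition cycle_curve :: "(int \<Rightarrow> 'a) \<Rightarrow> real \<Rightarrow> 'a \<Rightarrow> real" where
  "cycle_curve c t = edge_point (c \<lfloor>t\<rfloor>) (c (\<lfloor>t\<rfloor> + 1)) (frac t)"

lemma cycle_curve_eq:
  assumes "of_int i \<le> t" "t \<le> of_int i + 1"
  shows "cycle_curve c t = edge_point (c i) (c (i + 1)) (t - of_int i)"
proof (cases "t = of_int i + 1")
  case True
  then have "t = of_int (i + 1)" by simp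
  then show ?thesis by (simp add: cycle_curve_def)
next
  case False
  then have "\<lfloor>t\<rfloor> = i" using assms by (intro floor_unique) auto
  then show ?thesis by (simp add: cycle_curve_def frac_def)
qed

context connected_pair_graph
begin

text \<open>These are the vertex functions whose extension \<open>extend_potential\<close> is
  1-Lipschitz and so bounds distances from below.\<close>

definition potential :: "('a \<Rightarrow> real) \<Rightarrow> bool" where
  "potential h \<longleftrightarrow> (\<forall>(u, v)\<in>E. \<bar>h u - h v\<bar> \<le> 1)"

lemma extend_potential_edge:
  assumes "potential h" "(u, v) \<in> E" "0 \<le> t" "t \<le> 1"
  shows "extend_potential h (edge_point u v t) = min (h u + t) (h v + 1 - t)"
proof -
  have h: "\<bar>h u - h v\<bar> \<le> 1" and uv: "u \<noteq> v" using assms E_neq by (auto simp: potential_def)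
  consider "t = 0" | "t = 1" | "0 < t" "t < 1" using assms by linarith
  then show ?thesis
  proof cases
    case 3
    then show ?thesis
      using point_supp_edge[OF uv 3] uv by (simp add: extend_potential_def edge_point_left edge_point_right)
  qed (use h in auto)
qed

lemma extend_potential_le_dist:
  assumes h: "potential h" and "x \<in> X" "y \<in> X"
  shows "extend_potential h y - extend_potential h x \<le> d x y"
  using assms(2,3)
proof (rule lipschitz_le_dist)
  fix u v s t assume "(u, v) \<in> E" "s \<in> {0..1::real}" "t \<in> {0..1::real}"
  then show "extend_potential h (edge_point u v t) - extend_potential h (edge_point u v s) \<le> \<bar>s - t\<bar>"
    using extend_potential_edge[OF h] by (auto simp: min_def)
qed

text \<open>At the base point the extension of \<open>h\<close> takes the value
  \<open>min (2 * s) (2 - 2 * s)\<close> instead of the desired 0. On its edge the extension is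
  therefore replaced by \<open>\<bar>t - s\<bar>\<close>, which agrees with \<open>h\<close> at both
  ends; the result is still 1-Lipschitz and vanishes at the base point.\<close>

lemma extend_potential_le_dist_edge_point:
  assumes h: "potential h" and uv: "(u, v) \<in> E" and s: "0 \<le> s" "s \<le> 1" "h u = s" "h v = 1 - s"
    and Q: "Q \<in> X" "point_supp Q \<noteq> {u, v}"
  shows "extend_potential h Q \<le> d (edge_point u v s) Q"
proof -
  define \<Phi> where "\<Phi> R = (if point_supp R = {u, v} then \<bar>R v - s\<bar> else extend_potential h R)" for R
  have nuv: "u \<noteq> v" using E_neq[OF uv] .
  have on: "\<Phi> (edge_point u v t) = \<bar>t - s\<bar>" if t: "0 \<le> t" "t \<le> 1" for t
  proof -
    consider "t = 0" | "t = 1" | "0 < t" "t < 1" using t by linarith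
    then show ?thesis
    proof cases
      case 3
      then show ?thesis using point_supp_edge[OF nuv 3] nuv by (simp add: \<Phi>_def edge_point_right)
    qed (use nuv s in \<open>auto simp: \<Phi>_def\<close>)
  qed
  have off: "\<Phi> (edge_point a b t) = extend_potential h (edge_point a b t)"
    if ab: "(a, b) \<in> E" "{a, b} \<noteq> {u, v}" and t: "0 \<le> t" "t \<le> 1" for a b t
  proof -
    consider "t = 0" | "t = 1" | "0 < t" "t < 1" using t by linarith
    then have "point_supp (edge_point a b t) \<noteq> {u, v}"
    proof cases
      case 3
      then show ?thesis using point_supp_edge[OF E_neq[OF ab(1)] 3] ab(2) by simp
    qed (use nuv in auto)
    then show ?thesis by (simp add: \<Phi>_def)
  qed
  have "\<Phi> Q - \<Phi> (edge_point u v s) \<le> d (edge_point u v s) Q"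
    using edge_point_in_X[OF uv s(1,2)] Q(1)
  proof (rule lipschitz_le_dist)
    fix a b r t assume ab: "(a, b) \<in> E" "r \<in> {0..1::real}" "t \<in> {0..1::real}"
    consider "a = u" "b = v" | "a = v" "b = u" | "{a, b} \<noteq> {u, v}"
      using doubleton_eq_iff[of a b u v] by argo
    then show "\<Phi> (edge_point a b t) - \<Phi> (edge_point a b r) \<le> \<bar>r - t\<bar>"
    proof cases
      case 1
      then show ?thesis using on ab by auto
    next
      case 2
      then show ?thesis using on[of "1 - t"] on[of "1 - r"] ab by (auto simp: edge_point_swap[of u v])
    next
      case 3
      then show ?thesis using off ab extend_potential_edge[OF h ab(1)] by (auto simp: min_def)
    qed
  qed
  then show ?thesis using Q(2) on[of s] s by (simp add: \<Phi>_def)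
qed

text \<open>If the ends are as far apart as their parameters, the triangle inequality leaves no
  slack for any intermediate pair.\<close>

lemma isometric_curveI:
  assumes "\<And>t. a \<le> t \<Longrightarrow> t \<le> b \<Longrightarrow> \<gamma> t \<in> X"
    and lip: "\<And>s t. a \<le> s \<Longrightarrow> s \<le> t \<Longrightarrow> t \<le> b \<Longrightarrow> d (\<gamma> s) (\<gamma> t) \<le> t - s"
    and far: "b - a \<le> d (\<gamma> a) (\<gamma> b)"
  shows "isometric_curve X d \<gamma> a b"
proof -
  have eq: "d (\<gamma> s) (\<gamma> t) = t - s" if "a \<le> s" "s \<le> t" "t \<le> b" for s t
    using lip[of a s] lip[of s t] lip[of t b] far that assms(1)
      dist_triangle[of "\<gamma> a" "\<gamma> s" "\<gamma> b"] dist_triangle[of "\<gamma> s" "\<gamma> t" "\<gamma> b"] by force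
  have "d (\<gamma> s) (\<gamma> t) = \<bar>s - t\<bar>" if "s \<in> {a..b}" "t \<in> {a..b}" for s t
    using eq[of s t] eq[of t s] that dist_sym[of "\<gamma> s" "\<gamma> t"] by (cases "s \<le> t") auto
  then show ?thesis using assms(1) by (auto simp: isometric_curve_def)
qed

lemma is_geodesic_curve_image:
  assumes "isometric_curve X d \<gamma> a b" "a \<le> b"
  shows "is_geodesic X d (\<gamma> a) (\<gamma> b) (\<gamma> ` {a..b})"
proof (rule is_geodesicI[of "b - a" _ _ "\<lambda>t. \<gamma> (a + t)"])
  show "isometric_curve X d (\<lambda>t. \<gamma> (a + t)) 0 (b - a)"
    using assms(1) by (auto simp: isometric_curve_def)
  have "{a..b} = (+) a ` {0..b - a}" by simp
  then show "\<gamma> ` {a..b} = (\<lambda>t. \<gamma> (a + t)) ` {0..b - a}" by (simp only: image_image)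
qed (use assms(2) in auto)

text \<open>The third side of the triangle is the single point \<open>\<sigma> a\<close>, which lies
  on the second half anyway. As the curve is closed, the one estimate \<open>half\<close> makes both
  halves geodesics. The start \<open>a\<close> is left free because it has to be the midpoint of an
  edge in the complete graph on four vertices.\<close>

lemma closed_curve_le_hyperbolicity:
  assumes "3 \<le> card V" "0 \<le> L"
    and inX: "\<And>t. \<sigma> t \<in> X"
    and lip: "\<And>s t. s \<le> t \<Longrightarrow> d (\<sigma> s) (\<sigma> t) \<le> t - s"
    and closed: "\<sigma> (a + L) = \<sigma> a"
    and half: "L / 2 \<le> d (\<sigma> a) (\<sigma> (a + L / 2))"
    and quarter: "\<And>t. a + L / 2 \<le> t \<Longrightarrow> t \<le> a + L \<Longrightarrow> L / 4 \<le> d (\<sigma> (a + L / 4)) (\<sigma> t)"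
  shows "L / 4 \<le> graph_hyperbolicity G"
proof -
  define A where "A = \<sigma> ` {a..a + L / 2}"
  define B where "B = \<sigma> ` {a + L / 2..a + L}"
  have "is_geodesic X d (\<sigma> a) (\<sigma> (a + L / 2)) A"
    unfolding A_def using assms(2) inX lip half by (intro is_geodesic_curve_image isometric_curveI) auto
  moreover have "is_geodesic X d (\<sigma> (a + L / 2)) (\<sigma> (a + L)) B"
    unfolding B_def using assms(2) inX lip half closed dist_sym[of "\<sigma> a"]
    by (intro is_geodesic_curve_image isometric_curveI) auto
  moreover have "is_geodesic X d (\<sigma> a) (\<sigma> a) {\<sigma> a}"
    using is_geodesic_curve_image[of \<sigma> a a] inX by (simp add: isometric_curve_def)
  ultimately have "is_geodesic_triangle X d (A, B, {\<sigma> a})"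
    using inX closed unfolding is_geodesic_triangle_def by auto
  then have "dist_to_set d (\<sigma> (a + L / 4)) (B \<union> {\<sigma> a}) \<le> graph_hyperbolicity G"
    using assms(1,2) by (intro dist_to_set_le_hyperbolicity) (auto simp: A_def)
  moreover have "\<sigma> a \<in> B" unfolding B_def using closed assms(2) by (intro image_eqI[of _ _ "a + L"]) auto
  then have "L / 4 \<le> dist_to_set d (\<sigma> (a + L / 4)) (B \<union> {\<sigma> a})"
    unfolding dist_to_set_def using quarter by (intro cINF_greatest) (auto simp: B_def insert_absorb)
  ultimately show ?thesis by linarith
qed

section \<open>Curves running round a cycle\<close>

lemma cycle_curve_in_X: "(\<And>i. (c i, c (i + 1)) \<in> E) \<Longrightarrow> cycle_curve c t \<in> X"
  unfolding cycle_curve_def by (intro edge_point_in_X) (auto simp: frac_ge_0 frac_lt_1 less_imp_le)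

text \<open>Cutting at the next integer time reduces the number of integers passed, and within one
  edge the distance is known.\<close>

lemma cycle_curve_lipschitz:
  assumes c: "\<And>i. (c i, c (i + 1)) \<in> E" and "s \<le> t"
  shows "d (cycle_curve c s) (cycle_curve c t) \<le> t - s"
proof -
  have "d (cycle_curve c s) (cycle_curve c t) \<le> t - s" if "s \<le> t" "nat (\<lfloor>t\<rfloor> - \<lfloor>s\<rfloor>) \<le> k" for k s t
    using that
  proof (induction k arbitrary: s)
    case (0 s)
    then have "\<lfloor>t\<rfloor> = \<lfloor>s\<rfloor>" using floor_mono[of s t] by simp
    then have "t \<le> of_int \<lfloor>s\<rfloor> + 1" using floor_correct[of t] by linarith
    then show ?case
      using dist_edge[OF c, of "s - of_int \<lfloor>s\<rfloor>" "t - of_int \<lfloor>s\<rfloor>" "\<lfloor>s\<rfloor>"] 0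
        cycle_curve_eq[of "\<lfloor>s\<rfloor>" s c] cycle_curve_eq[of "\<lfloor>s\<rfloor>" t c] floor_correct[of s] by auto
  next
    case (Suc k s)
    define r where "r = min t (of_int (\<lfloor>s\<rfloor> + 1))"
    have r: "s \<le> r" "r \<le> t" "r \<le> of_int \<lfloor>s\<rfloor> + 1"
      using floor_correct[of s] Suc.prems by (auto simp: r_def less_imp_le)
    have "d (cycle_curve c s) (cycle_curve c r) = r - s"
      using dist_edge[OF c, of "s - of_int \<lfloor>s\<rfloor>" "r - of_int \<lfloor>s\<rfloor>" "\<lfloor>s\<rfloor>"] r
        cycle_curve_eq[of "\<lfloor>s\<rfloor>" s c] cycle_curve_eq[of "\<lfloor>s\<rfloor>" r c] floor_correct[of s] by auto
    moreover have "nat (\<lfloor>t\<rfloor> - \<lfloor>r\<rfloor>) \<le> k"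
      using Suc.prems by (auto simp: r_def min_def)
    then have "d (cycle_curve c r) (cycle_curve c t) \<le> t - r" using Suc.IH r by blast
    ultimately show ?case
      using dist_triangle[of "cycle_curve c s" "cycle_curve c r" "cycle_curve c t"] cycle_curve_in_X[where c = c, OF c]
      by force
  qed
  then show ?thesis using assms(2) by blast
qed

end

definition cycle_vertex :: "nat \<Rightarrow> int \<Rightarrow> nat" where
  "cycle_vertex L i = nat (i mod int L)"

lemma cycle_vertex_nat: "j < L \<Longrightarrow> cycle_vertex L (int j) = j"
  by (simp add: cycle_vertex_def)

lemma cycle_vertex_period [simp]: "cycle_vertex L (int L) = 0"
  by (simp add: cycle_vertex_def)

lemma cycle_vertex_edge:
  assumes "0 < L" and step: "\<And>j. Suc j < L \<Longrightarrow> (j, Suc j) \<in> R" and last: "(L - 1, 0) \<in> R"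
  shows "(cycle_vertex L i, cycle_vertex L (i + 1)) \<in> R"
proof -
  define j where "j = cycle_vertex L i"
  have j: "j < L" "i mod int L = int j" using assms(1) by (auto simp: j_def cycle_vertex_def nat_less_iff)
  have "(i + 1) mod int L = (int j + 1) mod int L" using j(2) by (metis mod_add_left_eq)
  then have eq: "cycle_vertex L (i + 1) = nat ((int j + 1) mod int L)" by (simp add: cycle_vertex_def)
  have "cycle_vertex L (i + 1) = (if Suc j < L then Suc j else 0)"
  proof (cases "Suc j < L")
    case False
    then have "int j + 1 = int L" using j(1) by simp
    then show ?thesis using eq False by simp
  qed (use eq in simp)
  moreover have "j = L - 1" if "\<not> Suc j < L" using j(1) that by simp
  ultimately have "(j, cycle_vertex L (i + 1)) \<in> R" using step[of j] last by (cases "Suc j < L") auto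
  then show ?thesis by (simp add: j_def)
qed

text \<open>For the cycle \<open>0, \<dots>, L - 1\<close>: bounds from below for the distance to the point at position \<open>L / 4\<close>
  and for the distance to the vertex 0.\<close>

definition quarter_potential :: "nat \<Rightarrow> nat \<Rightarrow> real" where
  "quarter_potential L j = (if 2 * j \<le> L then \<bar>real j - real L / 4\<bar> else real L / 4)"

definition origin_potential :: "nat \<Rightarrow> nat \<Rightarrow> real" where
  "origin_potential L j = (if j < L then min (real j) (real L - real j) else 1)"

lemma cycle_le_hyperbolicity:
  fixes G :: "nat pair_pre_digraph"
  assumes "connected_pair_graph G" and L: "3 \<le> L"
    and step: "\<And>j. Suc j < L \<Longrightarrow> (j, Suc j) \<in> parcs G" and last: "(L - 1, 0) \<in> parcs G"
    and pot: "connected_pair_graph.potential G (quarter_potential L)"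
      "connected_pair_graph.potential G (origin_potential L)"
  shows "real L / 4 \<le> graph_hyperbolicity G"
proof -
  interpret connected_pair_graph G by fact
  let ?c = "cycle_vertex L"
  define \<sigma> where "\<sigma> = cycle_curve ?c"
  have c: "(?c i, ?c (i + 1)) \<in> E" for i using L step last by (intro cycle_vertex_edge) auto
  have "{..<L} \<subseteq> V"
  proof
    fix j assume "j \<in> {..<L}"
    then show "j \<in> V" using E_V(1)[OF c[of "int j"]] cycle_vertex_nat[of j L] by simp
  qed
  then have card: "3 \<le> card V" using card_mono[OF pair_finite_verts, of "{..<L}"] L by simp
  have \<sigma>X: "\<sigma> t \<in> X" for t unfolding \<sigma>_def by (rule cycle_curve_in_X[where c = ?c, OF c])
  have ends: "\<sigma> 0 = vertex_point 0" "\<sigma> (real L) = vertex_point 0"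
    using cycle_curve_eq[of 0 0 ?c] cycle_curve_eq[of "int L" "real L" ?c] L
    by (simp_all add: \<sigma>_def cycle_vertex_def)
  have seg: "\<exists>j f. j < L \<and> t = real j + f \<and> 0 \<le> f \<and> f < 1 \<and>
      \<sigma> t = edge_point j (?c (int j + 1)) f \<and> (j, ?c (int j + 1)) \<in> E \<and>
      ?c (int j + 1) = (if Suc j < L then Suc j else 0)"
    if "0 \<le> t" "t < real L" for t
  proof -
    define j where "j = nat \<lfloor>t\<rfloor>"
    have j: "\<lfloor>t\<rfloor> = int j" using that by (simp add: j_def)
    then have "j < L" using that by linarith
    have "real j \<le> t" "t < real j + 1" using j floor_correct[of t] by auto
    then have "\<sigma> t = edge_point j (?c (int j + 1)) (t - real j)"
      using cycle_curve_eq[of "int j" t ?c] cycle_vertex_nat[OF \<open>j < L\<close>] by (simp add: \<sigma>_def)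
    moreover have "(j, ?c (int j + 1)) \<in> E" using c[of "int j"] cycle_vertex_nat[OF \<open>j < L\<close>] by simp
    moreover have "?c (int j + 1) = (if Suc j < L then Suc j else 0)"
    proof (cases "Suc j < L")
      case True
      then show ?thesis using cycle_vertex_nat[of "Suc j" L] by (simp add: add.commute)
    next
      case False
      then have "int j + 1 = int L" using \<open>j < L\<close> by simp
      then show ?thesis using False by simp
    qed
    ultimately show ?thesis using \<open>j < L\<close> \<open>real j \<le> t\<close> \<open>t < real j + 1\<close>
      by (intro exI[of _ j] exI[of _ "t - real j"]) auto
  qed
  have half: "real L / 2 \<le> d (\<sigma> 0) (\<sigma> (0 + real L / 2))"
  proof -
    obtain j f where j: "j < L" "real L / 2 = real j + f" "0 \<le> f" "f < 1"
      "\<sigma> (real L / 2) = edge_point j (?c (int j + 1)) f" "(j, ?c (int j + 1)) \<in> E"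
      "?c (int j + 1) = (if Suc j < L then Suc j else 0)"
      using seg[of "real L / 2"] L by auto
    have "Suc j < L" using j L by linarith
    then have "extend_potential (origin_potential L) (\<sigma> (real L / 2)) = real L / 2"
      using extend_potential_edge[OF pot(2) j(6), of f] j by (simp add: origin_potential_def min_def)
    then show ?thesis
      using extend_potential_le_dist[OF pot(2) \<sigma>X \<sigma>X, of "real L / 2" 0] ends L
      by (simp add: origin_potential_def)
  qed
  have quarter: "real L / 4 \<le> d (\<sigma> (0 + real L / 4)) (\<sigma> t)"
    if t: "0 + real L / 2 \<le> t" "t \<le> 0 + real L" for t
  proof -
    obtain i f where i: "i < L" "real L / 4 = real i + f" "0 \<le> f" "f < 1"
      "\<sigma> (real L / 4) = edge_point i (?c (int i + 1)) f" "(i, ?c (int i + 1)) \<in> E"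
      "?c (int i + 1) = (if Suc i < L then Suc i else 0)"
      using seg[of "real L / 4"] L by auto
    \<comment> \<open>Both ends of the edge carrying the point at position \<open>L / 4\<close> have
      index at most \<open>L / 2\<close>, so the potential there is the exact distance to that
      point, \<open>f\<close> and \<open>1 - f\<close>.\<close>
    have "4 * i \<le> L" using i(2,3) by linarith
    then have iL: "2 * Suc i \<le> L" using L by presburger
    then have ci: "?c (int i + 1) = Suc i" using i(7) by auto
    have "point_supp (\<sigma> t) \<noteq> {i, Suc i} \<and> real L / 4 \<le> extend_potential (quarter_potential L) (\<sigma> t)"
    proof (cases "t = real L")
      case True
      then show ?thesis using ends by (auto simp: quarter_potential_def)
    next
      case False
      then have "0 \<le> t" "t < real L" using t by auto
      then obtain j e where j: "j < L" "t = real j + e" "0 \<le> e" "e < 1"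
        "\<sigma> t = edge_point j (?c (int j + 1)) e" "(j, ?c (int j + 1)) \<in> E"
        "?c (int j + 1) = (if Suc j < L then Suc j else 0)"
        using seg[of t] by blast
      have supp: "point_supp (\<sigma> t) \<subseteq> {j, ?c (int j + 1)}"
        unfolding j(5) by (auto simp: point_supp_def edge_point_def vertex_point_def split: if_splits)
      have jL: "L < 2 * j + 2" using j t by linarith
      then have "i < j" using iL by simp
      have "point_supp (\<sigma> t) \<noteq> {i, Suc i}"
      proof
        assume "point_supp (\<sigma> t) = {i, Suc i}"
        then have "i = ?c (int j + 1)" "Suc i = j \<or> Suc i = ?c (int j + 1)"
          using supp \<open>i < j\<close> by auto
        then show False using j(1,7) L \<open>i < j\<close> by (cases "Suc j < L") simp_all
      qed
      moreover have "real L / 4 \<le> quarter_potential L (?c (int j + 1)) + 1 - e"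
        using j(4,7) jL by (auto simp: quarter_potential_def)
      \<comment> \<open>If \<open>j\<close> has not passed the middle, \<open>t \<ge> L / 2\<close>
        makes \<open>j + e - L / 4\<close> large enough; afterwards the potential alone is
        \<open>L / 4\<close>.\<close>
      moreover have "real L / 4 \<le> quarter_potential L j + e"
      proof (cases "2 * j \<le> L")
        case True
        then show ?thesis
          using abs_ge_self[of "real j - real L / 4"] j(2) t(1) by (simp add: quarter_potential_def)
      next
        case False
        then show ?thesis using j(3) by (simp add: quarter_potential_def)
      qed
      ultimately show ?thesis using extend_potential_edge[OF pot(1) j(6), of e] j by simp
    qed
    moreover have "quarter_potential L i = \<bar>real i - real L / 4\<bar>"
        "quarter_potential L (Suc i) = \<bar>real (Suc i) - real L / 4\<bar>"
      using iL by (simp_all add: quarter_potential_def)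
    then have "quarter_potential L i = f" "quarter_potential L (Suc i) = 1 - f"
      using i(2-4) by linarith+
    ultimately show ?thesis
      using extend_potential_le_dist_edge_point[OF pot(1), of i "Suc i" f "\<sigma> t"] i ci \<sigma>X by simp
  qed
  show ?thesis
    using card \<sigma>X cycle_curve_lipschitz[where c = ?c, OF c] ends half quarter
    by (intro closed_curve_le_hyperbolicity[of "real L" \<sigma> 0]) (auto simp: \<sigma>_def)
qed

section \<open>Extremal graphs\<close>

definition all_pairs :: "nat \<Rightarrow> nat set set" where
  "all_pairs n = {{u, v} |u v. u < v \<and> v < n}"

lemma all_pairsI: "u \<noteq> v \<Longrightarrow> u < n \<Longrightarrow> v < n \<Longrightarrow> {u, v} \<in> all_pairs n"
  unfolding all_pairs_def using insert_commute[of u v "{}"] by (metis (mono_tags, lifting) CollectI linorder_neqE_nat)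

lemma all_pairsD: "{u, v} \<in> all_pairs n \<Longrightarrow> u < n \<and> v < n \<and> u \<noteq> v"
  by (auto simp: all_pairs_def doubleton_eq_iff)

lemma finite_all_pairs: "finite (all_pairs n)"
  by (rule finite_subset[of _ "Pow {..<n}"]) (auto simp: all_pairs_def)

definition graph_of_edges :: "nat \<Rightarrow> nat set set \<Rightarrow> nat pair_pre_digraph" where
  "graph_of_edges n F = \<lparr>pverts = {..<n}, parcs = {(u, v). {u, v} \<in> F}\<rparr>"

lemma graph_of_edges_simps [simp]:
  "pverts (graph_of_edges n F) = {..<n}"
  "(u, v) \<in> parcs (graph_of_edges n F) \<longleftrightarrow> {u, v} \<in> F"
  by (simp_all add: graph_of_edges_def)

lemma graph_of_edges_in_graphs_of:
  assumes "1 \<le> n" and F: "F \<subseteq> all_pairs n"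
    and reach: "\<And>v. v < n \<Longrightarrow> (0, v) \<in> (parcs (graph_of_edges n F))\<^sup>*"
  shows "graph_of_edges n F \<in> graphs_of n (card F)"
proof -
  let ?G = "graph_of_edges n F"
  have bound: "u < n \<and> v < n \<and> u \<noteq> v" if "(u, v) \<in> parcs ?G" for u v
    using that F all_pairsD by auto
  have "finite (parcs ?G)" by (rule finite_subset[of _ "{..<n} \<times> {..<n}"]) (use bound in auto)
  moreover have sym: "sym (parcs ?G)" by (auto simp: sym_def insert_commute)
  ultimately have pg: "pair_graph ?G"
    using bound by unfold_locales (force simp: symmetric_def)+
  then interpret pair_graph ?G .
  have "parcs (mk_symmetric (with_proj ?G)) = parcs ?G"
    using adj_mk_symmetric_eq pair_sym_arcs by simp
  moreover have "(u, v) \<in> rtrancl_on {..<n} (parcs ?G)" if "u < n" "v < n" for u v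
  proof -
    have "(u, 0) \<in> (parcs ?G)\<^sup>*" using reach[OF that(1)] sym by (metis sym_rtrancl symD)
    then have "(u, v) \<in> (parcs ?G)\<^sup>*" using reach[OF that(2)] by (rule rtrancl_trans)
    then show ?thesis
    proof (induction rule: rtrancl_induct)
      case (step y z)
      have "z \<in> {..<n}" using bound[OF step.hyps(2)] by blast
      then show ?case by (rule rtrancl_on_into_rtrancl_on[OF step.IH step.hyps(2)])
    qed (use that in simp)
  qed
  ultimately have "connected (with_proj ?G)"
    using assms(1) by (auto simp: connected_def strongly_connected_def reachable_def lessThan_empty_iff)
  moreover have "{{u, v} |u v. (u, v) \<in> parcs ?G} = F"
  proof
    show "F \<subseteq> {{u, v} |u v. (u, v) \<in> parcs ?G}"
    proof
      fix e assume "e \<in> F"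
      then obtain u v where "e = {u, v}" using F by (auto simp: all_pairs_def)
      then show "e \<in> {{u, v} |u v. (u, v) \<in> parcs ?G}" using \<open>e \<in> F\<close> by auto
    qed
  qed auto
  ultimately show ?thesis using pg by (simp add: graphs_of_def)
qed

lemma graphs_of_connected: "G \<in> graphs_of n m \<Longrightarrow> connected_pair_graph G"
  by (auto simp: graphs_of_def connected_pair_graph_def connected_pair_graph_axioms_def)

lemma finite_graphs_of: "finite (graphs_of n m)"
proof (rule finite_subset)
  show "graphs_of n m \<subseteq> (\<lambda>R. \<lparr>pverts = {..<n}, parcs = R\<rparr>) ` Pow ({..<n} \<times> {..<n})"
  proof
    fix G assume G: "G \<in> graphs_of n m"
    then interpret connected_pair_graph G by (rule graphs_of_connected)
    have "pverts G = {..<n}" using G by (simp add: graphs_of_def)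
    then have "parcs G \<subseteq> {..<n} \<times> {..<n}" using E_V by auto
    moreover have "G = \<lparr>pverts = {..<n}, parcs = parcs G\<rparr>" using \<open>pverts G = {..<n}\<close> by (cases G) simp
    ultimately show "G \<in> (\<lambda>R. \<lparr>pverts = {..<n}, parcs = R\<rparr>) ` Pow ({..<n} \<times> {..<n})" by blast
  qed
qed simp

text \<open>A star. It keeps the maximum in the tree case from being taken over the empty
  set.\<close>

lemma tree_exists:
  assumes "1 \<le> n"
  shows "graphs_of n (n - 1) \<noteq> {}"
proof -
  define F where "F = (\<lambda>v::nat. {0, v}) ` {1..<n}"
  have "card F = n - 1"
    unfolding F_def by (subst card_image) (auto simp: inj_on_def doubleton_eq_iff)
  moreover have "graph_of_edges n F \<in> graphs_of n (card F)"
  proof (rule graph_of_edges_in_graphs_of[OF assms])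
    show "F \<subseteq> all_pairs n" by (auto simp: F_def intro: all_pairsI)
    fix v assume "v < n"
    then have "v = 0 \<or> (0, v) \<in> parcs (graph_of_edges n F)" by (auto simp: F_def)
    then show "(0, v) \<in> (parcs (graph_of_edges n F))\<^sup>*" by auto
  qed
  ultimately show ?thesis by auto
qed

text \<open>The edges that may be present without spoiling the two distance estimates behind the
  triangle on the cycle. The number of edges that a graph with this cycle can be given is thus read
  off from the cardinality of this set.\<close>

definition compatible_pairs :: "nat \<Rightarrow> nat \<Rightarrow> nat set set" where
  "compatible_pairs n L = {{u, v} |u v. u < v \<and> v < n \<and>
     \<bar>quarter_potential L u - quarter_potential L v\<bar> \<le> 1 \<and>
     \<bar>origin_potential L u - origin_potential L v\<bar> \<le> 1}"

lemma compatible_pairs_subset: "compatible_pairs n L \<subseteq> all_pairs n"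
  by (auto simp: compatible_pairs_def all_pairs_def)

lemma compatible_pairsI:
  assumes "u \<noteq> v" "u < n" "v < n" "\<bar>quarter_potential L u - quarter_potential L v\<bar> \<le> 1"
    "\<bar>origin_potential L u - origin_potential L v\<bar> \<le> 1"
  shows "{u, v} \<in> compatible_pairs n L"
proof (cases "u < v")
  case True
  then show ?thesis using assms unfolding compatible_pairs_def by blast
next
  case False
  then have "v < u" "{u, v} = {v, u}" using assms by auto
  then show ?thesis
    using assms abs_minus_commute[of "quarter_potential L u"] abs_minus_commute[of "origin_potential L u"]
    unfolding compatible_pairs_def by (intro CollectI exI[of _ v] exI[of _ u]) auto
qed

lemma compatible_pairsD:
  "{u, v} \<in> compatible_pairs n L \<Longrightarrow> \<bar>quarter_potential L u - quarter_potential L v\<bar> \<le> 1 \<and>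
     \<bar>origin_potential L u - origin_potential L v\<bar> \<le> 1"
  by (auto simp: compatible_pairs_def doubleton_eq_iff abs_minus_commute)

lemma quarter_potential_low: "2 * j \<le> L \<Longrightarrow> quarter_potential L j = \<bar>real j - real L / 4\<bar>"
  and quarter_potential_high: "L < 2 * j \<Longrightarrow> quarter_potential L j = real L / 4"
  by (simp_all add: quarter_potential_def)

lemma cycle_step_compatible:
  assumes "Suc i < L" "L \<le> n"
  shows "{i, Suc i} \<in> compatible_pairs n L"
proof (rule compatible_pairsI)
  show "\<bar>origin_potential L i - origin_potential L (Suc i)\<bar> \<le> 1"
    using assms by (auto simp: origin_potential_def min_def)
  consider "2 * Suc i \<le> L" | "2 * i \<le> L" "L < 2 * Suc i" | "L < 2 * i" by linarith
  then show "\<bar>quarter_potential L i - quarter_potential L (Suc i)\<bar> \<le> 1"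
  proof cases
    case 1
    then have "quarter_potential L i = \<bar>real i - real L / 4\<bar>"
      "quarter_potential L (Suc i) = \<bar>real i + 1 - real L / 4\<bar>"
      by (simp_all add: quarter_potential_low add.commute)
    then show ?thesis by linarith
  next
    \<comment> \<open>The edge crosses the middle, where the potential is capped at
      \<open>L / 4\<close>; as \<open>i\<close> is within 1 of \<open>L / 2\<close>, the jump is at
      most 1.\<close>
    case 2
    then have "quarter_potential L i = \<bar>real i - real L / 4\<bar>" "quarter_potential L (Suc i) = real L / 4"
      using quarter_potential_low quarter_potential_high by blast+
    moreover have "real (2 * i) \<le> real L" "real L < real (2 * Suc i)"
      using 2 by (simp_all only: of_nat_le_iff of_nat_less_iff)
    then have "2 * real i \<le> real L" "real L < 2 * real i + 2" by simp_all
    then have "\<bar>\<bar>real i - real L / 4\<bar> - real L / 4\<bar> \<le> 1"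
      by (cases "real L / 4 \<le> real i") (simp_all add: abs_if)
    ultimately show ?thesis by simp
  next
    case 3
    then show ?thesis by (simp add: quarter_potential_high)
  qed
qed (use assms in auto)

text \<open>A vertex outside the cycle has the same two potentials as \<open>L - 1\<close>, namely
  \<open>L / 4\<close> and 1, and behaves like a copy of that neighbour of 0. The set sees only the
  values 0 and 1 of one potential, and \<open>L / 4\<close> and \<open>\<bar>1 - L / 4\<bar>\<close>
  of the other.\<close>

lemma clique_compatible:
  assumes "3 \<le> L" "L \<le> n" and C: "u \<in> {0, 1, L - 1} \<union> {L..<n}" "v \<in> {0, 1, L - 1} \<union> {L..<n}" "u \<noteq> v"
  shows "{u, v} \<in> compatible_pairs n L"
proof (rule compatible_pairsI)
  have o: "origin_potential L w = 0 \<or> origin_potential L w = 1" if "w \<in> {0, 1, L - 1} \<union> {L..<n}" for w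
    using that assms(1) by (auto simp: origin_potential_def min_def)
  show "\<bar>origin_potential L u - origin_potential L v\<bar> \<le> 1" using o[OF C(1)] o[OF C(2)] by auto
  have "quarter_potential L w = real L / 4 \<or> quarter_potential L w = \<bar>1 - real L / 4\<bar>"
    if "w \<in> {0, 1, L - 1} \<union> {L..<n}" for w
    using that assms(1) by (auto simp: quarter_potential_def)
  then have "quarter_potential L u = real L / 4 \<or> quarter_potential L u = \<bar>1 - real L / 4\<bar>"
    "quarter_potential L v = real L / 4 \<or> quarter_potential L v = \<bar>1 - real L / 4\<bar>"
    using C(1,2) by blast+
  then show "\<bar>quarter_potential L u - quarter_potential L v\<bar> \<le> 1" using assms(1) by linarith
qed (use assms in auto)

text \<open>The cycle and one edge from 0 to each vertex outside it are at most \<open>n\<close>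
  edges and already connect everything. Further compatible pairs preserve both potentials, so the
  number of edges can be adjusted to \<open>m\<close> exactly.\<close>

lemma exists_graph_with_cycle:
  assumes L: "3 \<le> L" "L \<le> n" and m: "n \<le> m" "m \<le> card (compatible_pairs n L)"
  obtains G where "G \<in> graphs_of n m" "real L / 4 \<le> graph_hyperbolicity G"
proof -
  define base where "base = (\<lambda>i. {i, Suc i}) ` {..<L - 1} \<union> insert {0, L - 1} ((\<lambda>j. {0, j}) ` {L..<n})"
  have "card base \<le> card ((\<lambda>i. {i, Suc i}) ` {..<L - 1}) + Suc (card ((\<lambda>j. {0, j}) ` {L..<n}))"
    unfolding base_def by (rule order_trans[OF card_Un_le]) (simp add: card_insert_if)
  also have "\<dots> \<le> (L - 1) + Suc (n - L)"
    using card_image_le[of "{..<L - 1}" "\<lambda>i. {i, Suc i}"] card_image_le[of "{L..<n}" "\<lambda>j. {0, j}"] by simp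
  also have "\<dots> = n" using L by simp
  finally have "card base \<le> m" using m by simp
  moreover have "base \<subseteq> compatible_pairs n L"
    using L by (auto simp: base_def intro: cycle_step_compatible clique_compatible)
  moreover have "finite (compatible_pairs n L)"
    using compatible_pairs_subset finite_all_pairs by (rule finite_subset)
  ultimately obtain F where F: "base \<subseteq> F" "F \<subseteq> compatible_pairs n L" "card F = m"
    using m(2) by (metis exists_subset_between)
  let ?G = "graph_of_edges n F"
  have step: "(j, Suc j) \<in> parcs ?G" if "Suc j < L" for j
    using that F(1) by (auto simp: base_def)
  have last: "(L - 1, 0) \<in> parcs ?G" using F(1) by (auto simp: base_def insert_commute)
  have cyc: "(0, j) \<in> (parcs ?G)\<^sup>*" if "j < L" for j
    using that
  proof (induction j)
    case (Suc j)
    then show ?case using step[of j] by (simp add: rtrancl.rtrancl_into_rtrancl)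
  qed simp
  have "(0, v) \<in> (parcs ?G)\<^sup>*" if "v < n" for v
  proof (cases "v < L")
    case False
    then have "(0, v) \<in> parcs ?G" using F(1) that by (auto simp: base_def)
    then show ?thesis by blast
  qed (rule cyc)
  then have G: "?G \<in> graphs_of n m"
    using graph_of_edges_in_graphs_of[of n F] F(3) order_trans[OF F(2) compatible_pairs_subset] L by simp
  then interpret connected_pair_graph ?G by (rule graphs_of_connected)
  have "potential (quarter_potential L)" "potential (origin_potential L)"
    using F(2) compatible_pairsD by (auto simp: potential_def)
  then have "real L / 4 \<le> graph_hyperbolicity ?G"
    using L step last by (intro cycle_le_hyperbolicity connected_pair_graph_axioms) auto
  then show ?thesis using that G by blast
qed

text \<open>The cycle edges \<open>{0, 1}\<close> and \<open>{0, L - 1}\<close> lie in the clique;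
  the other \<open>L - 2\<close> do not, except for \<open>L = 3\<close>, where the clique contains
  all vertices.\<close>

lemma card_compatible_pairs_clique:
  assumes L: "3 \<le> L" "L \<le> n"
  shows "((n - L + 3) choose 2) + (if L = 3 then 0 else L - 2) \<le> card (compatible_pairs n L)"
proof -
  define C where "C = {0, 1, L - 1} \<union> {L..<n}"
  define K where "K = {B. B \<subseteq> C \<and> card B = 2}"
  have finC: "finite C" by (simp add: C_def)
  have "card C = card {0, 1, L - 1} + card {L..<n}"
    unfolding C_def using L by (intro card_Un_disjoint) auto
  also have "\<dots> = n - L + 3" using L by simp
  finally have K: "card K = (n - L + 3) choose 2" unfolding K_def using n_subsets[OF finC] by simp
  have KC: "K \<subseteq> compatible_pairs n L"
    using clique_compatible[OF L] by (auto simp: K_def C_def card_2_iff)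
  have fin: "finite (compatible_pairs n L)"
    using compatible_pairs_subset finite_all_pairs by (rule finite_subset)
  show ?thesis
  proof (cases "L = 3")
    case True
    then show ?thesis using card_mono[OF fin KC] K by simp
  next
    case False
    define P where "P = (\<lambda>i. {i, Suc i}) ` {1..<L - 1}"
    have "card P = L - 2" unfolding P_def by (subst card_image) (auto simp: inj_on_def doubleton_eq_iff)
    moreover have "{i, Suc i} \<notin> K" if "1 \<le> i" "i < L - 1" for i
    proof
      assume "{i, Suc i} \<in> K"
      then have "i \<in> C" "Suc i \<in> C" by (auto simp: K_def)
      then show False using that False L by (auto simp: C_def)
    qed
    then have "K \<inter> P = {}" unfolding P_def by fastforce
    moreover have "finite K" "finite P" using finC by (simp_all add: K_def P_def)
    ultimately have "card (K \<union> P) = ((n - L + 3) choose 2) + (L - 2)" using K by (simp add: card_Un_disjoint)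
    moreover have "K \<union> P \<subseteq> compatible_pairs n L"
      using KC cycle_step_compatible L by (auto simp: P_def)
    ultimately show ?thesis using card_mono[OF fin, of "K \<union> P"] False by simp
  qed
qed

text \<open>The three chords lie near the vertex \<open>0\<close> and near the point opposite to it.\<close>

lemma card_compatible_pairs_Hamiltonian:
  assumes n: "5 \<le> n"
  shows "n + 3 \<le> card (compatible_pairs n n)"
proof -
  \<comment> \<open>The largest index below \<open>n / 2\<close>. The chord from \<open>k\<close> to
    \<open>k + 2\<close> skips a vertex at or next to the point opposite 0, and
    \<open>n - (k + 2)\<close> is \<open>k\<close> or \<open>k - 1\<close>, so the distances of its
    ends to 0 along the cycle differ by at most 1.\<close>
  define k where "k = (n - 1) div 2"
  have k: "2 \<le> k" "2 * k + 1 \<le> n" "n \<le> 2 * k + 2" "k + 2 < n" using n by (auto simp: k_def)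
  define P where "P = (\<lambda>i. {i, Suc i}) ` {..<n - 1}"
  define Q where "Q = {{0, n - 1}, {1, n - 1}, {1, n - 2}, {k, k + 2}}"
  have fin: "finite (compatible_pairs n n)"
    using compatible_pairs_subset finite_all_pairs by (rule finite_subset)
  have "card P = n - 1" unfolding P_def by (subst card_image) (auto simp: inj_on_def doubleton_eq_iff)
  \<comment> \<open>Here \<open>5 \<le> n\<close> enters: for four vertices
    \<open>{1, n - 1}\<close> and \<open>{k, k + 2}\<close> coincide.\<close>
  moreover have "card Q = 4" using n k by (simp add: Q_def doubleton_eq_iff)
  moreover have "{a, b} \<notin> P" if "a + 2 \<le> b" for a b
    using that by (auto simp: P_def doubleton_eq_iff)
  then have "P \<inter> Q = {}" using n k(1) unfolding Q_def by simp
  ultimately have "card (P \<union> Q) = n + 3"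
    using n by (subst card_Un_disjoint) (auto simp: P_def Q_def)
  moreover have "P \<subseteq> compatible_pairs n n" using cycle_step_compatible by (auto simp: P_def)
  moreover have "{0, n - 1} \<in> compatible_pairs n n" "{1, n - 1} \<in> compatible_pairs n n"
    using n by (auto intro!: clique_compatible)
  moreover have "{1, n - 2} \<in> compatible_pairs n n"
  proof (rule compatible_pairsI)
    have "quarter_potential n 1 = \<bar>1 - real n / 4\<bar>" "quarter_potential n (n - 2) = real n / 4"
      using quarter_potential_low[of 1 n] quarter_potential_high[of n "n - 2"] n by simp_all
    then show "\<bar>quarter_potential n 1 - quarter_potential n (n - 2)\<bar> \<le> 1" by linarith
    show "\<bar>origin_potential n 1 - origin_potential n (n - 2)\<bar> \<le> 1"
      using n by (simp add: origin_potential_def min_def)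
  qed (use n in auto)
  moreover have "{k, k + 2} \<in> compatible_pairs n n"
  proof (rule compatible_pairsI)
    have "quarter_potential n k = \<bar>real k - real n / 4\<bar>" "quarter_potential n (k + 2) = real n / 4"
      using quarter_potential_low[of k n] quarter_potential_high[of n "k + 2"] k by simp_all
    moreover have "2 * real k + 1 \<le> real n" "real n \<le> 2 * real k + 2" using k by linarith+
    ultimately show "\<bar>quarter_potential n k - quarter_potential n (k + 2)\<bar> \<le> 1" by linarith
    show "\<bar>origin_potential n k - origin_potential n (k + 2)\<bar> \<le> 1"
      using k by (simp add: origin_potential_def min_def)
  qed (use k in auto)
  ultimately show ?thesis using card_mono[OF fin, of "P \<union> Q"] by (simp add: Q_def)
qed

text \<open>In the complete graph \<open>K\<^sub>4\<close> the extremal curve starts at the midpoint of an edge.\<close>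

lemma complete_graph_4:
  obtains G where "G \<in> graphs_of 4 6" "1 \<le> graph_hyperbolicity G"
proof -
  let ?G = "graph_of_edges 4 (all_pairs 4)" and ?c = "cycle_vertex 4"
  have "all_pairs 4 = {B. B \<subseteq> {..<4} \<and> card B = 2}"
  proof (rule set_eqI)
    fix B :: "nat set"
    show "B \<in> all_pairs 4 \<longleftrightarrow> B \<in> {B. B \<subseteq> {..<4} \<and> card B = 2}"
      using all_pairsI[of _ _ 4] by (auto simp: card_2_iff) (auto simp: all_pairs_def)
  qed
  then have "card (all_pairs 4) = 6" using n_subsets[of "{..<4::nat}" 2] by (simp add: choose_two)
  moreover have "?G \<in> graphs_of 4 (card (all_pairs 4))"
  proof (rule graph_of_edges_in_graphs_of)
    fix v :: nat assume "v < 4"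
    then have "v = 0 \<or> (0, v) \<in> parcs ?G" using all_pairsI[of 0 v 4] by auto
    then show "(0, v) \<in> (parcs ?G)\<^sup>*" by auto
  qed auto
  ultimately have G: "?G \<in> graphs_of 4 6" by simp
  then interpret connected_pair_graph ?G by (rule graphs_of_connected)
  define \<sigma> where "\<sigma> = cycle_curve ?c"
  have E: "(u, v) \<in> E \<longleftrightarrow> u < 4 \<and> v < 4 \<and> u \<noteq> v" for u v
    using all_pairsI[of u v 4] all_pairsD[of u v 4] by auto
  have c: "(?c i, ?c (i + 1)) \<in> E" for i by (rule cycle_vertex_edge) (simp_all only: E, simp_all)
  have \<sigma>X: "\<sigma> t \<in> X" for t unfolding \<sigma>_def by (rule cycle_curve_in_X[where c = ?c, OF c])
  have piece: "\<sigma> t = edge_point 3 0 (t + 1)" if "-1 \<le> t" "t \<le> 0" for t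
    using cycle_curve_eq[of "-1" t ?c] that by (simp add: \<sigma>_def cycle_vertex_def)
  have piece0: "\<sigma> t = edge_point 0 1 t" if "0 \<le> t" "t \<le> 1" for t
    using cycle_curve_eq[of 0 t ?c] that by (simp add: \<sigma>_def cycle_vertex_def)
  have piece1: "\<sigma> t = edge_point 1 2 (t - 1)" if "1 \<le> t" "t \<le> 2" for t
    using cycle_curve_eq[of 1 t ?c] that by (simp add: \<sigma>_def cycle_vertex_def)
  have piece2: "\<sigma> t = edge_point 2 3 (t - 2)" if "2 \<le> t" "t \<le> 3" for t
    using cycle_curve_eq[of 2 t ?c] that by (simp add: \<sigma>_def cycle_vertex_def)
  have piece3: "\<sigma> t = edge_point 3 0 (t - 3)" if "3 \<le> t" "t \<le> 4" for t
    using cycle_curve_eq[of 3 t ?c] that by (simp add: \<sigma>_def cycle_vertex_def)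
  have supp: "point_supp (edge_point u v t) \<subseteq> {u, v}" for u v :: nat and t
    by (auto simp: point_supp_def edge_point_def vertex_point_def split: if_splits)
  \<comment> \<open>\<open>k\<close> is the distance from the midpoint of the edge between 3 and 0,
    where the curve starts. \<open>h\<close> bounds the distance from the midpoint of the edge
    between 0 and 1, a quarter of the way along, and is cut off at the required value 1.\<close>
  define k :: "nat \<Rightarrow> real" where "k j = (if j = 3 \<or> j = 0 then 1 / 2 else 3 / 2)" for j
  define h :: "nat \<Rightarrow> real" where "h j = (if j = 0 \<or> j = 1 then 1 / 2 else 1)" for j
  have pot: "potential k" "potential h" by (auto simp: potential_def k_def h_def)
  have "2 \<le> d (\<sigma> (- 1 / 2)) (\<sigma> (3 / 2))"
  proof -
    have "extend_potential k (\<sigma> (3 / 2)) = 2"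
      using extend_potential_edge[OF pot(1), of 1 2 "1 / 2"] piece1[of "3 / 2"] E by (simp add: k_def)
    moreover have "point_supp (\<sigma> (3 / 2)) \<noteq> {3, 0}"
      using supp[of 1 2 "1 / 2"] piece1[of "3 / 2"] by auto
    ultimately show ?thesis
      using extend_potential_le_dist_edge_point[OF pot(1), of 3 0 "1 / 2" "\<sigma> (3 / 2)"] \<sigma>X E
        piece[of "- 1 / 2"] by (simp add: k_def)
  qed
  moreover have "1 \<le> d (\<sigma> (1 / 2)) (\<sigma> t)" if t: "3 / 2 \<le> t" "t \<le> 7 / 2" for t
  proof -
    consider "t \<le> 2" | "2 \<le> t" "t \<le> 3" | "3 \<le> t" by linarith
    then have "1 \<le> extend_potential h (\<sigma> t) \<and> point_supp (\<sigma> t) \<noteq> {0, 1}"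
    proof cases
      case 1
      then show ?thesis
        using extend_potential_edge[OF pot(2), of 1 2 "t - 1"] piece1[of t] E t supp[of 1 2 "t - 1"]
        by (auto simp: h_def)
    next
      case 2
      then show ?thesis
        using extend_potential_edge[OF pot(2), of 2 3 "t - 2"] piece2[of t] E supp[of 2 3 "t - 2"]
        by (auto simp: h_def)
    next
      case 3
      then show ?thesis
        using extend_potential_edge[OF pot(2), of 3 0 "t - 3"] piece3[of t] E t supp[of 3 0 "t - 3"]
        by (auto simp: h_def)
    qed
    then show ?thesis
      using extend_potential_le_dist_edge_point[OF pot(2), of 0 1 "1 / 2" "\<sigma> t"] \<sigma>X E piece0[of "1 / 2"]
      by (auto simp: h_def)
  qed
  moreover have "\<sigma> (7 / 2) = \<sigma> (- 1 / 2)" using piece[of "- 1 / 2"] piece3[of "7 / 2"] by simp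
  ultimately have "4 / 4 \<le> graph_hyperbolicity ?G"
    using \<sigma>X cycle_curve_lipschitz[where c = ?c, OF c]
    by (intro closed_curve_le_hyperbolicity[of 4 \<sigma> "- 1 / 2"]) (auto simp: \<sigma>_def)
  then show ?thesis using that G by simp
qed

lemma max_hyperbolicity_ge:
  "G \<in> graphs_of n m \<Longrightarrow> c \<le> graph_hyperbolicity G \<Longrightarrow> c \<le> max_hyperbolicity n m"
  unfolding max_hyperbolicity_def using finite_graphs_of by (meson Max_ge finite_imageI imageI order_trans)

lemma exists_graph_quarter:
  assumes "3 \<le> n" "n \<le> m" "m \<le> n + 3" "m \<le> n choose 2"
  obtains G where "G \<in> graphs_of n m" "real n / 4 \<le> graph_hyperbolicity G"
proof (cases "n = 4 \<and> m = 6")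
  \<comment> \<open>On the cycle of length 4 the pair \<open>{0, 2}\<close> joins opposite vertices
    and is not compatible, so the complete graph needs its own triangle.\<close>
  case True
  then show ?thesis using complete_graph_4 that by auto
next
  case False
  have "m \<le> card (compatible_pairs n n)"
  proof (cases "5 \<le> n")
    case True
    then show ?thesis using card_compatible_pairs_Hamiltonian[of n] assms by simp
  next
    case n: False
    then have "n = 3 \<or> n = 4" using assms(1) by linarith
    then show ?thesis
      using card_compatible_pairs_clique[of n n] assms False by (auto simp: choose_two)
  qed
  then show ?thesis using exists_graph_with_cycle[of n n m] assms that by auto
qed

theorem theorem3p2:
  fixes n m :: nat
  assumes "1 \<le> n" and "n - 1 \<le> m" and "m \<le> n choose 2"
  shows "(m = n - 1 \<longrightarrow> max_hyperbolicity n m = 0) \<and>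
    (3 \<le> n \<and> n \<le> m \<and> m \<le> n + 3 \<longrightarrow> max_hyperbolicity n m = real n / 4) \<and>
    (\<forall>n\<^sub>0::nat. 5 \<le> n\<^sub>0 \<and> n\<^sub>0 \<le> n \<and>
        n + ((n\<^sub>0 - 2) choose 2) < m \<and> m \<le> n + ((n\<^sub>0 - 1) choose 2) \<longrightarrow>
      max_hyperbolicity n m \<ge> (real n - real n\<^sub>0 + 3) / 4)"
proof (intro conjI impI allI)
  assume m: "m = n - 1"
  have "graph_hyperbolicity G = 0" if G: "G \<in> graphs_of n m" for G
  proof -
    interpret connected_pair_graph G using G by (rule graphs_of_connected)
    show ?thesis using G m by (intro graph_hyperbolicity_tree) (simp add: graphs_of_def edge_set_def)
  qed
  then have "graph_hyperbolicity ` graphs_of n m = {0}" using tree_exists[OF assms(1)] m by auto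
  then show "max_hyperbolicity n m = 0" by (simp add: max_hyperbolicity_def)
next
  assume m: "3 \<le> n \<and> n \<le> m \<and> m \<le> n + 3"
  obtain G where G: "G \<in> graphs_of n m" "real n / 4 \<le> graph_hyperbolicity G"
    using exists_graph_quarter m assms(3) by blast
  have "graph_hyperbolicity H \<le> real n / 4" if H: "H \<in> graphs_of n m" for H
  proof -
    interpret connected_pair_graph H using H by (rule graphs_of_connected)
    show ?thesis using graph_hyperbolicity_le_card H m by (simp add: graphs_of_def)
  qed
  then have "max_hyperbolicity n m \<le> real n / 4"
    unfolding max_hyperbolicity_def using finite_graphs_of G(1) by (intro Max.boundedI) auto
  moreover have "real n / 4 \<le> max_hyperbolicity n m" using G by (rule max_hyperbolicity_ge)
  ultimately show "max_hyperbolicity n m = real n / 4" by simp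
next
  fix n\<^sub>0 :: nat
  assume n0: "5 \<le> n\<^sub>0 \<and> n\<^sub>0 \<le> n \<and> n + ((n\<^sub>0 - 2) choose 2) < m \<and> m \<le> n + ((n\<^sub>0 - 1) choose 2)"
  define L where "L = n - n\<^sub>0 + 3"
  have L: "3 \<le> L" "L \<le> n" "n - L + 3 = n\<^sub>0" using n0 by (auto simp: L_def)
  have pascal: "(n\<^sub>0 choose 2) = ((n\<^sub>0 - 1) choose 2) + (n\<^sub>0 - 1)"
    using n0 by (cases n\<^sub>0) (simp_all add: numeral_2_eq_2)
  have "m \<le> card (compatible_pairs n L)"
  proof (cases "L = 3")
    \<comment> \<open>The clique then contains all vertices, and \<open>m \<le> n choose 2\<close>
      is the limit given by its edges.\<close>
    case True
    then have "n\<^sub>0 = n" using L by simp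
    then show ?thesis using card_compatible_pairs_clique[OF L(1,2)] L(3) assms(3) True by simp
  next
    case False
    have "n\<^sub>0 - 1 + (L - 2) = n" using n0 by (simp add: L_def)
    moreover have "(n\<^sub>0 choose 2) + (L - 2) \<le> card (compatible_pairs n L)"
      using card_compatible_pairs_clique[OF L(1,2)] L(3) False by simp
    ultimately show ?thesis using n0 pascal by linarith
  qed
  moreover have "n \<le> m" using n0 by simp
  ultimately obtain G where "G \<in> graphs_of n m" "real L / 4 \<le> graph_hyperbolicity G"
    using exists_graph_with_cycle[OF L(1,2)] by blast
  then have "real L / 4 \<le> max_hyperbolicity n m" by (rule max_hyperbolicity_ge)
  then show "(real n - real n\<^sub>0 + 3) / 4 \<le> max_hyperbolicity n m" using n0 by (simp add: L_def)
qed

end
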